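(* $\mathrm{SL}_d(\mathbb{Z})$ is a lattice in $\mathrm{SL}_d(\mathbb{R})$.
   Context: A discrete subgroup $\Gamma$ of a Lie group $G$ is called a lattice if $\Gamma\backslash G$ has finite measure with respect to the measure $\mu$ induced from the left-invariant (Haar) measure $m$ on $G$, where $\mu(B)=m(\pi^{-1}(B)\cap F)$ for the factor map $\pi:G\to\Gamma\backslash G$ and any Borel fundamental set $F$ (a set with $G=\bigsqcup_{\gamma\in\Gamma}\gamma F$). *)

theory Defs
  imports "HOL-Analysis.Analysis" "HOL-Algebra.Coset"
begin

text \<open>A group \<open>G\<close> whose elements live in a topological space carries the subspace topology
  and the Borel sets of that topology.\<close>

definition borel_carrier :: "('a::topological_space, 'b) monoid_scheme \<Rightarrow> 'a measure" where
  "borel_carrier G = restrict_space borel (carrier G)"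

definition discrete_subgroup ::
    "'a::topological_space set \<Rightarrow> ('a, 'b) monoid_scheme \<Rightarrow> bool" where
  "discrete_subgroup \<Gamma> G \<longleftrightarrow> group G \<and> subgroup \<Gamma> G \<and> discrete \<Gamma>"

text \<open>A nonzero left-invariant Borel measure on \<open>G\<close> that is finite on compact sets. Inner and outer
  regularity are not demanded: they are automatic for locally compact second countable groups, in
  particular for Lie groups with countably many components.\<close>

definition left_haar_measure ::
    "('a::topological_space, 'b) monoid_scheme \<Rightarrow> 'a measure \<Rightarrow> bool" where
  "left_haar_measure G m \<longleftrightarrow>
     space m = carrier G \<and>
     sets m = sets (borel_carrier G) \<and>
     (\<forall>g\<in>carrier G. \<forall>B\<in>sets m. emeasure m (g <#\<^bsub>G\<^esub> B) = emeasure m B) \<and>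
     (\<forall>K. compact K \<and> K \<subseteq> carrier G \<longrightarrow> emeasure m K < \<infinity>) \<and>
     emeasure m (carrier G) \<noteq> 0"

definition borel_fundamental_set ::
    "('a::topological_space, 'b) monoid_scheme \<Rightarrow> 'a set \<Rightarrow> 'a set \<Rightarrow> bool" where
  "borel_fundamental_set G \<Gamma> F \<longleftrightarrow>
     F \<in> sets (borel_carrier G) \<and>
     (\<Union>\<gamma>\<in>\<Gamma>. \<gamma> <#\<^bsub>G\<^esub> F) = carrier G \<and>
     disjoint_family_on (\<lambda>\<gamma>. \<gamma> <#\<^bsub>G\<^esub> F) \<Gamma>"

text \<open>The points of \<open>\<Gamma>\<backslash>G\<close> are the cosets \<open>\<Gamma>g\<close>, which the library calls right cosets; the measurable
  sets are the Borel sets of the quotient topology.\<close>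

definition quotient_borel ::
    "('a::topological_space, 'b) monoid_scheme \<Rightarrow> 'a set \<Rightarrow> 'a set measure" where
  "quotient_borel G \<Gamma> =
     sigma (rcosets\<^bsub>G\<^esub> \<Gamma>)
       {U. U \<subseteq> rcosets\<^bsub>G\<^esub> \<Gamma> \<and>
           openin (top_of_set (carrier G)) {g \<in> carrier G. \<Gamma> #>\<^bsub>G\<^esub> g \<in> U}}"

definition quotient_measure ::
    "('a::topological_space, 'b) monoid_scheme \<Rightarrow> 'a set \<Rightarrow> 'a measure \<Rightarrow> 'a set \<Rightarrow> 'a set measure"
  where
  "quotient_measure G \<Gamma> m F =
     distr (restrict_space m F) (quotient_borel G \<Gamma>) (\<lambda>g. \<Gamma> #>\<^bsub>G\<^esub> g)"

lemma quotient_proj_measurable: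
  assumes "space m = carrier G" "sets m = sets (borel_carrier G)"
  shows "(\<lambda>g. \<Gamma> #>\<^bsub>G\<^esub> g) \<in> measurable m (quotient_borel G \<Gamma>)"
  unfolding quotient_borel_def
proof (rule measurable_measure_of)
  fix U assume "U \<in> {U. U \<subseteq> rcosets\<^bsub>G\<^esub> \<Gamma> \<and>
           openin (top_of_set (carrier G)) {g \<in> carrier G. \<Gamma> #>\<^bsub>G\<^esub> g \<in> U}}"
  then obtain T where T: "open T" "{g \<in> carrier G. \<Gamma> #>\<^bsub>G\<^esub> g \<in> U} = carrier G \<inter> T"
    by (auto simp: openin_open)
  have "(\<lambda>g. \<Gamma> #>\<^bsub>G\<^esub> g) -` U \<inter> space m = carrier G \<inter> T"
    using T(2) assms(1) by auto
  then show "(\<lambda>g. \<Gamma> #>\<^bsub>G\<^esub> g) -` U \<inter> space m \<in> sets m"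
    using T(1) by (auto simp: assms(2) borel_carrier_def sets_restrict_space)
qed (auto simp: assms(1) RCOSETS_def)

lemma emeasure_quotient_measure:
  assumes m: "left_haar_measure G m"
    and F: "borel_fundamental_set G \<Gamma> F"
    and B: "B \<in> sets (quotient_borel G \<Gamma>)"
  shows "emeasure (quotient_measure G \<Gamma> m F) B =
         emeasure m ({g \<in> carrier G. \<Gamma> #>\<^bsub>G\<^esub> g \<in> B} \<inter> F)"
proof -
  have sp: "space m = carrier G" "sets m = sets (borel_carrier G)"
    using m by (auto simp: left_haar_measure_def)
  have Fm: "F \<in> sets m"
    using F sp by (simp add: borel_fundamental_set_def)
  have FG: "F \<subseteq> carrier G"
    using sets.sets_into_space[OF Fm] sp by simp
  have meas: "(\<lambda>g. \<Gamma> #>\<^bsub>G\<^esub> g) \<in> measurable (restrict_space m F) (quotient_borel G \<Gamma>)"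
    by (intro measurable_restrict_space1 quotient_proj_measurable sp)
  have eq: "(\<lambda>g. \<Gamma> #>\<^bsub>G\<^esub> g) -` B \<inter> space (restrict_space m F) =
            {g \<in> carrier G. \<Gamma> #>\<^bsub>G\<^esub> g \<in> B} \<inter> F"
    using FG by (auto simp: space_restrict_space sp)
  show ?thesis
    unfolding quotient_measure_def emeasure_distr[OF meas B] eq
    using Fm by (subst emeasure_restrict_space) (auto simp: sets.Int_space_eq2)
qed

text \<open>The Haar measure (unique up to scaling) and the fundamental set are universally quantified, so
  the total mass is finite for every choice of them; that such choices exist is part of the
  definition, which rules out a vacuous reading.\<close>

definition is_lattice ::
    "'a::topological_space set \<Rightarrow> ('a, 'b) monoid_scheme \<Rightarrow> bool" where
  "is_lattice \<Gamma> G \<longleftrightarrow>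
     discrete_subgroup \<Gamma> G \<and>
     (\<exists>m. left_haar_measure G m) \<and>
     (\<exists>F. borel_fundamental_set G \<Gamma> F) \<and>
     (\<forall>m F. left_haar_measure G m \<and> borel_fundamental_set G \<Gamma> F \<longrightarrow>
        finite_measure (quotient_measure G \<Gamma> m F))"

definition SL_real :: "(real^'n^'n) monoid" where
  "SL_real = \<lparr>carrier = {A. det A = 1}, mult = (**), one = mat 1\<rparr>"

definition SL_int :: "(real^'n^'n) set" where
  "SL_int = {A. det A = 1 \<and> (\<forall>i j. A $ i $ j \<in> \<int>)}"

lemma group_SL_real: "group (SL_real :: (real^'n^'n) monoid)"
proof (rule groupI)
  fix A :: "real^'n^'n" assume "A \<in> carrier SL_real"
  then have A: "det A = 1" by (simp add: SL_real_def)
  then obtain B where B: "B ** A = mat 1"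
    using invertible_det_nz[of A] by (auto simp: invertible_def)
  then have "det B = 1"
    using det_mul[of B A] A by simp
  with B show "\<exists>B\<in>carrier SL_real. B \<otimes>\<^bsub>SL_real\<^esub> A = \<one>\<^bsub>SL_real\<^esub>"
    by (auto simp: SL_real_def)
qed (auto simp: SL_real_def det_mul matrix_mul_assoc)

end

theory Submission
  imports Defs
begin

text \<open>
  Write \<open>G\<close> and \<open>\<Gamma>\<close> for the real and the integral group, and let \<open>m\<close> be any left Haar measure.

  Finite volume comes from reduction theory. The Iwasawa decomposition writes \<open>g \<in> G\<close> as \<open>T Q\<close> with
  \<open>T\<close> lower triangular with positive diagonal and \<open>Q\<close> orthogonal. Among all the products \<open>\<gamma> g\<close>
  choose one that minimises the energy \<open>\<Sum>\<^sub>i 4\<^sup>-\<^sup>i T\<^sub>i\<^sub>i\<^sup>2\<close>. A lattice basis with bounded energy can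
  be size reduced, and then it is bounded, so that only finitely many energies lie below a given
  one and the minimum exists; exchanging two neighbouring rows cannot
  lower the energy, and this forces \<open>T\<^sub>i\<^sub>i \<le> 2 T\<^sub>j\<^sub>j\<close> for the successor \<open>j\<close> of \<open>i\<close>
  (\<open>ex_reduced_representative\<close>). Hence \<open>G = \<Gamma> S\<close> for a Siegel set \<open>S\<close>.

  To bound \<open>m(S)\<close>, cut \<open>S\<close> into pieces \<open>S\<^sub>k\<close> on which the ratio of the diagonal entries of index
  \<open>i + 1\<close> and \<open>i\<close> is about \<open>2 ^ k\<^sub>i\<close>. Left translation by a diagonal matrix of determinant one
  turns \<open>S\<^sub>k\<close> into a subset of a fixed compact region, but it also contracts the subdiagonal entries of the
  unipotent part to size \<open>2 ^ (- k\<^sub>i)\<close>. Therefore \<open>\<Prod>\<^sub>i 2 ^ k\<^sub>i\<close> pairwise disjoint left translates of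
  the contracted piece fit into one compact set of measure \<open>M\<close>, whence
  \<open>m(S\<^sub>k) \<le> M \<Prod>\<^sub>i 2 ^ (- k\<^sub>i)\<close> (\<open>siegel_block_packing\<close>), and these bounds have a finite sum.
  A fundamental set has at most the measure of any Borel set whose
  translates by \<open>\<Gamma>\<close> cover \<open>G\<close> (\<open>fundamental_set_le_cover\<close>).

  A Haar measure is exhibited by giving to \<open>B \<subseteq> G\<close> the Lebesgue measure of the cone
  \<open>{t A | 0 < t \<le> 1, A \<in> B}\<close>; it is invariant because left multiplication by a matrix \<open>A\<close> scales
  the Lebesgue measure on matrices by a power of \<open>\<bar>det A\<bar>\<close> (\<open>left_scaling_det\<close>). A fundamental set
  exists because \<open>\<Gamma>\<close> is discrete and \<open>G\<close> is second countable.
\<close>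

section \<open>Integer matrices of determinant one\<close>

lemma SL_real_simps [simp]:
  "carrier SL_real = {A. det A = 1}"
  "A \<otimes>\<^bsub>SL_real\<^esub> B = A ** B"
  "\<one>\<^bsub>SL_real\<^esub> = mat 1"
  by (simp_all add: SL_real_def)

lemma l_coset_SL_real: "A <#\<^bsub>SL_real\<^esub> X = (\<lambda>B. A ** B) ` X"
  by (auto simp: l_coset_def)

lemma SL_inverse:
  fixes A :: "real^'n^'n"
  assumes "det A = 1"
  obtains B where "det B = 1" "A ** B = mat 1" "B ** A = mat 1"
proof -
  obtain B where B: "A ** B = mat 1" "B ** A = mat 1"
    using assms invertible_det_nz[of A] by (auto simp: invertible_def)
  moreover have "det B = 1"
    using det_mul[of A B] B assms by simp
  ultimately show ?thesis using that by blast
qed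

lemma Ints_det:
  fixes A :: "real^'n^'n"
  assumes "\<And>i j. A $ i $ j \<in> \<int>"
  shows "det A \<in> \<int>"
  unfolding det_def using assms by (intro Ints_sum) (auto intro!: Ints_mult Ints_prod)

lemma SL_int_mult: "A \<in> SL_int \<Longrightarrow> B \<in> SL_int \<Longrightarrow> A ** B \<in> SL_int"
  unfolding SL_int_def by (simp add: det_mul) (auto simp: matrix_matrix_mult_def)

lemma mat_1_SL_int: "mat 1 \<in> SL_int"
  by (simp add: SL_int_def) (simp add: mat_def)

text \<open>By Cramer's rule the entries of the inverse are determinants of integer matrices.\<close>

lemma SL_int_inverse:
  fixes A :: "real^'n^'n"
  assumes "A \<in> SL_int"
  obtains B where "B \<in> SL_int" "A ** B = mat 1" "B ** A = mat 1"
proof -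
  have A: "det A = 1" "\<And>i j. A $ i $ j \<in> \<int>"
    using assms by (auto simp: SL_int_def)
  obtain B where B: "det B = 1" "A ** B = mat 1" "B ** A = mat 1"
    using SL_inverse[OF A(1)] .
  have "B $ k $ l \<in> \<int>" for k l
  proof -
    have "A *v column l B = axis l 1"
      using B(2) by (simp add: vec_eq_iff column_def matrix_vector_mult_def matrix_matrix_mult_def
          mat_def axis_def)
    then have "column l B = (\<chi> k. det (\<chi> i j. if j = k then axis l 1 $ i else A $ i $ j) / det A)"
      using cramer[of A "column l B" "axis l 1"] A(1) by simp
    then have "B $ k $ l = det (\<chi> i j. if j = k then axis l 1 $ i else A $ i $ j)"
      using A(1) by (simp add: vec_eq_iff column_def)
    also have "\<dots> \<in> \<int>"
      by (rule Ints_det) (simp add: A(2) axis_def)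
    finally show ?thesis .
  qed
  with B that show ?thesis by (auto simp: SL_int_def)
qed

lemma subgroup_SL_int: "subgroup (SL_int :: (real^'n^'n) set) SL_real"
proof (rule group.subgroupI[OF group_SL_real])
  show "SL_int \<subseteq> carrier SL_real" by (auto simp: SL_int_def)
  show "SL_int \<noteq> {}" using mat_1_SL_int by auto
  fix A :: "real^'n^'n" assume A: "A \<in> SL_int"
  obtain B where B: "B \<in> SL_int" "B ** A = mat 1"
    using SL_int_inverse[OF A] by auto
  then have "inv\<^bsub>SL_real\<^esub> A = B"
    using A by (intro group.inv_equality[OF group_SL_real]) (auto simp: SL_int_def)
  then show "inv\<^bsub>SL_real\<^esub> A \<in> SL_int" using B by simp
next
  fix A B :: "real^'n^'n" assume "A \<in> SL_int" "B \<in> SL_int"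
  then show "A \<otimes>\<^bsub>SL_real\<^esub> B \<in> SL_int" by (simp add: SL_int_mult)
qed

lemma SL_int_eqI:
  fixes A B :: "real^'n^'n"
  assumes "A \<in> SL_int" "B \<in> SL_int" "\<And>i j. \<bar>A $ i $ j - B $ i $ j\<bar> < 1"
  shows "A = B"
  unfolding vec_eq_iff using assms(1,2) by (auto simp: SL_int_def intro!: Ints_eq_abs_less1[THEN iffD2] assms(3))

lemma entry_dist_le: "\<bar>A $ i $ j - B $ i $ j\<bar> \<le> dist A (B :: real^'n^'m)"
proof -
  have "\<bar>(A - B) $ i $ j\<bar> \<le> norm ((A - B) $ i)" by (rule component_le_norm_cart)
  also have "\<dots> \<le> norm (A - B)" by (rule Finite_Cartesian_Product.norm_nth_le)
  finally show ?thesis by (simp add: dist_norm)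
qed

lemma discrete_subgroup_SL_int: "discrete_subgroup (SL_int :: (real^'n^'n) set) SL_real"
proof -
  have "\<And>A B :: real^'n^'n. A \<in> SL_int \<Longrightarrow> B \<in> SL_int \<Longrightarrow> dist A B < 1 \<Longrightarrow> B = A"
    by (metis SL_int_eqI entry_dist_le le_less_trans)
  then have "discrete (SL_int :: (real^'n^'n) set)"
    unfolding discrete_def isolated_in_dist_Ex_iff by (metis zero_less_one)
  then show ?thesis
    by (simp add: discrete_subgroup_def group_SL_real subgroup_SL_int)
qed

lemma finite_vectors_over_finite_set:
  assumes "finite S"
  shows "finite {v :: 'a^'n. \<forall>i. v $ i \<in> S}"
proof (rule finite_subset)
  show "{v :: 'a^'n. \<forall>i. v $ i \<in> S} \<subseteq> vec_lambda ` (UNIV \<rightarrow>\<^sub>E S)"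
  proof
    fix v :: "'a^'n" assume "v \<in> {v. \<forall>i. v $ i \<in> S}"
    then show "v \<in> vec_lambda ` (UNIV \<rightarrow>\<^sub>E S)"
      by (intro image_eqI[where x = "vec_nth v"]) auto
  qed
  show "finite (vec_lambda ` (UNIV \<rightarrow>\<^sub>E S) :: ('a^'n) set)"
    using assms by (intro finite_imageI finite_PiE) auto
qed

lemma finite_bounded_SL_int:
  "finite {A :: real^'n^'n. A \<in> SL_int \<and> (\<forall>i j. \<bar>A $ i $ j\<bar> \<le> R)}"
proof (rule finite_subset)
  let ?Z = "{x :: real. x \<in> \<int> \<and> \<bar>x\<bar> \<le> R}"
  show "{A :: real^'n^'n. A \<in> SL_int \<and> (\<forall>i j. \<bar>A $ i $ j\<bar> \<le> R)} \<subseteq> {A. \<forall>i. A $ i \<in> {v. \<forall>j. v $ j \<in> ?Z}}"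
    by (auto simp: SL_int_def)
  show "finite {A :: real^'n^'n. \<forall>i. A $ i \<in> {v. \<forall>j. v $ j \<in> ?Z}}"
    by (intro finite_vectors_over_finite_set finite_abs_int_segment)
qed

lemma countable_SL_int: "countable (SL_int :: (real^'n^'n) set)"
proof -
  have "SL_int \<subseteq> (\<Union>n::nat. {A :: real^'n^'n. A \<in> SL_int \<and> (\<forall>i j. \<bar>A $ i $ j\<bar> \<le> real n)})"
  proof safe
    fix A :: "real^'n^'n" assume "A \<in> SL_int"
    obtain n where "norm A \<le> real n" using real_arch_simple by blast
    then have "\<And>i j. \<bar>A $ i $ j\<bar> \<le> real n"
      using entry_dist_le[of A _ _ 0] by (simp) (metis order_trans)
    with \<open>A \<in> SL_int\<close> show "A \<in> (\<Union>n::nat. {A. A \<in> SL_int \<and> (\<forall>i j. \<bar>A $ i $ j\<bar> \<le> real n)})" by blast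
  qed
  then show ?thesis
    by (rule countable_subset) (intro countable_UN countable_finite finite_bounded_SL_int countableI_type)
qed

section \<open>Triangular matrices\<close>

text \<open>Triangularity needs an order on the index type, which is merely finite; an arbitrary enumeration
  supplies one.\<close>

definition idx :: "'n::finite \<Rightarrow> nat" where
  "idx = (SOME r. bij_betw r UNIV {..<CARD('n)})"

lemma bij_betw_idx: "bij_betw (idx :: 'n::finite \<Rightarrow> nat) UNIV {..<CARD('n)}"
proof -
  have "\<exists>r. bij_betw r (UNIV :: 'n set) {..<CARD('n)}"
    using ex_bij_betw_finite_nat[OF finite_class.finite_UNIV[where 'a='n]] by (simp add: atLeast0LessThan)
  then show ?thesis unfolding idx_def by (rule someI_ex)
qed

lemma idx_eq_iff [simp]: "idx i = idx j \<longleftrightarrow> i = j"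
  using bij_betw_idx by (auto simp: bij_betw_def inj_on_def)

lemma idx_less_card: "idx (i :: 'n::finite) < CARD('n)"
  using bij_betw_idx by (auto simp: bij_betw_def)

lemma ex_idx: "n < CARD('n) \<Longrightarrow> \<exists>i :: 'n::finite. idx i = n"
  using bij_betw_idx[where 'n='n] unfolding bij_betw_def by (metis imageE lessThan_iff)

definition lower_triangular :: "real^'n^'n \<Rightarrow> bool" where
  "lower_triangular T \<longleftrightarrow> (\<forall>i j. idx i < idx j \<longrightarrow> T $ i $ j = 0)"

text \<open>A permutation that never increases the index preserves the sum of all indices, so it fixes
  everything; only the identity contributes to the Leibniz sum.\<close>

lemma det_lower_triangular:
  fixes T :: "real^'n^'n"
  assumes "lower_triangular T"
  shows "det T = (\<Prod>i\<in>UNIV. T $ i $ i)"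
proof -
  have zero: "of_int (sign p) * (\<Prod>i\<in>UNIV. T $ i $ p i) = 0"
    if p: "p permutes UNIV" and "p \<noteq> id" for p :: "'n \<Rightarrow> 'n"
  proof -
    have "\<exists>i. idx i < idx (p i)"
    proof (rule ccontr)
      assume "\<not> ?thesis"
      then have le: "\<And>i. idx (p i) \<le> idx i" by (simp add: not_less)
      have "(\<Sum>i\<in>UNIV. idx (p i)) = (\<Sum>i\<in>(UNIV :: 'n set). idx i)"
        using sum.permute[OF p, of idx] unfolding o_def by (rule sym)
      then have "\<And>i. idx (p i) = idx i"
        using sum_mono_inv[of "\<lambda>i. idx (p i)" UNIV idx] le by simp
      then show False using \<open>p \<noteq> id\<close> by (auto simp: fun_eq_iff)
    qed
    then obtain i where "T $ i $ p i = 0" using assms by (auto simp: lower_triangular_def)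
    then have "(\<Prod>i\<in>UNIV. T $ i $ p i) = 0" by (intro prod_zero) auto
    then show ?thesis by simp
  qed
  have "det T = (\<Sum>p\<in>{id}. of_int (sign p) * (\<Prod>i\<in>UNIV. T $ i $ p i))"
    unfolding det_def by (rule sum.mono_neutral_right) (auto simp: permutes_id zero)
  then show ?thesis by (simp add: sign_id)
qed

lemma lower_triangular_mult:
  assumes "lower_triangular S" "lower_triangular T"
  shows "lower_triangular (S ** T)"
  unfolding lower_triangular_def
proof (intro allI impI)
  fix i j :: 'a assume "idx i < idx j"
  then have "S $ i $ k = 0 \<or> T $ k $ j = 0" for k
    using assms by (cases "idx i < idx k") (auto simp: lower_triangular_def not_less dest: le_less_trans)
  then show "(S ** T) $ i $ j = 0" unfolding matrix_matrix_mult_def by (auto intro!: sum.neutral)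
qed

lemma lower_triangular_mult_diag:
  assumes "lower_triangular S" "lower_triangular T"
  shows "(S ** T) $ i $ i = S $ i $ i * T $ i $ i"
proof -
  have "(S ** T) $ i $ i = (\<Sum>k\<in>{i}. S $ i $ k * T $ k $ i)"
    unfolding matrix_matrix_mult_def vec_lambda_beta
  proof (rule sum.mono_neutral_right, goal_cases)
    case 3
    have "S $ i $ k * T $ k $ i = 0" if "k \<noteq> i" for k
    proof (cases "idx i < idx k")
      case True
      then show ?thesis using assms by (simp add: lower_triangular_def)
    next
      case False
      then have "idx k < idx i" using that by (simp add: order.strict_iff_order not_less)
      then show ?thesis using assms by (simp add: lower_triangular_def)
    qed
    then show ?case by blast
  qed auto
  then show ?thesis by simp
qed

section \<open>Orthogonal matrices and the Iwasawa decomposition\<close>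

text \<open>Acting on column pairs this is a plane rotation. With \<open>c = 0\<close> and \<open>s = - 1\<close> it is the
  integer matrix that exchanges two rows up to sign.\<close>

definition rot :: "'n \<Rightarrow> 'n \<Rightarrow> real \<Rightarrow> real \<Rightarrow> real^'n^'n" where
  "rot i j c s = (\<chi> a b.
     if a = i \<and> b = i \<or> a = j \<and> b = j then c
     else if a = i \<and> b = j then - s
     else if a = j \<and> b = i then s
     else if a = b then 1 else 0)"

lemma mult_rot_right:
  assumes "i \<noteq> j"
  shows "(M ** rot i j c s) $ a $ b =
    (if b = i then c * M $ a $ i + s * M $ a $ j
     else if b = j then c * M $ a $ j - s * M $ a $ i else M $ a $ b)"
proof -
  have "(M ** rot i j c s) $ a $ b =
    (\<Sum>k\<in>UNIV. (if k = i then M $ a $ i * rot i j c s $ i $ b else 0) +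
      (if k = j then M $ a $ j * rot i j c s $ j $ b else 0) +
      (if k = b then (if b = i \<or> b = j then 0 else M $ a $ b) else 0))"
    unfolding matrix_matrix_mult_def vec_lambda_beta
    using assms by (intro sum.cong) (auto simp: rot_def)
  then show ?thesis
    using assms by (simp add: sum.distrib rot_def)
qed

lemma mult_rot_left:
  assumes "i \<noteq> j"
  shows "(rot i j c s ** M) $ a $ b =
    (if a = i then c * M $ i $ b - s * M $ j $ b
     else if a = j then s * M $ i $ b + c * M $ j $ b else M $ a $ b)"
proof -
  have "(rot i j c s ** M) $ a $ b =
    (\<Sum>k\<in>UNIV. (if k = i then rot i j c s $ a $ i * M $ i $ b else 0) +
      (if k = j then rot i j c s $ a $ j * M $ j $ b else 0) +
      (if k = a then (if a = i \<or> a = j then 0 else M $ a $ b) else 0))"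
    unfolding matrix_matrix_mult_def vec_lambda_beta
    using assms by (intro sum.cong) (auto simp: rot_def)
  then show ?thesis
    using assms by (simp add: sum.distrib rot_def)
qed

lemma rot_mult_rot:
  assumes "i \<noteq> j"
  shows "rot i j c s ** rot i j c' s' = rot i j (c * c' - s * s') (c * s' + s * c')"
proof -
  have "(rot i j c s ** rot i j c' s') $ a $ b
      = rot i j (c * c' - s * s') (c * s' + s * c') $ a $ b" for a b
    unfolding mult_rot_left[OF assms] using assms
    by (cases "a = i"; cases "a = j"; cases "b = i"; cases "b = j") (simp_all add: rot_def)
  then show ?thesis by (simp add: vec_eq_iff)
qed

lemma orthogonal_matrix_rot:
  assumes "i \<noteq> j" "c\<^sup>2 + s\<^sup>2 = 1"
  shows "orthogonal_matrix (rot i j c s)"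
proof -
  have "Finite_Cartesian_Product.transpose (rot i j c s) $ a $ b = rot i j c (- s) $ a $ b" for a b
    using assms(1) by (cases "a = i"; cases "a = j"; cases "b = i"; cases "b = j")
      (simp_all add: Finite_Cartesian_Product.transpose_def rot_def)
  then have "Finite_Cartesian_Product.transpose (rot i j c s) = rot i j c (- s)"
    by (simp add: vec_eq_iff)
  moreover have "rot i j c (- s) ** rot i j c s = rot i j 1 0"
    using assms(2) by (simp add: rot_mult_rot[OF assms(1)] power2_eq_square)
  moreover have "(rot i j 1 0 :: real^'a^'a) $ a $ b = mat 1 $ a $ b" for a b
    using assms(1) by (cases "a = i"; cases "a = j"; cases "b = i"; cases "b = j")
      (simp_all add: rot_def mat_def)
  then have "rot i j 1 0 = mat 1"
    by (simp add: vec_eq_iff)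
  ultimately show ?thesis by (simp add: orthogonal_matrix)
qed

text \<open>The quarter turn is the square of the eighth turn.\<close>

lemma det_quarter_turn:
  assumes "i \<noteq> j"
  shows "det (rot i j 0 (- 1)) = 1"
proof -
  let ?r = "sqrt (1 / 2)"
  let ?R = "rot i j ?r (- ?r)"
  have r: "?r * ?r = 1 / 2" by (rule real_sqrt_mult_self[THEN trans]) simp
  have "orthogonal_matrix ?R"
    using r by (intro orthogonal_matrix_rot assms) (simp add: power2_eq_square)
  then have "det ?R * det ?R = 1"
    using det_orthogonal_matrix by fastforce
  moreover have "?R ** ?R = rot i j 0 (- 1)"
    using r by (simp add: rot_mult_rot[OF assms])
  ultimately show ?thesis using det_mul[of ?R ?R] by simp
qed

lemma SL_int_quarter_turn: "i \<noteq> j \<Longrightarrow> rot i j 0 (- 1) \<in> SL_int"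
  unfolding SL_int_def by (simp add: det_quarter_turn) (simp add: rot_def)

definition householder :: "real^'n \<Rightarrow> real^'n^'n" where
  "householder v = (\<chi> i j. (if i = j then 1 else 0) - 2 * v $ i * v $ j / (v \<bullet> v))"

lemma mult_householder:
  "(M ** householder v) $ i $ j = M $ i $ j - 2 * (M $ i \<bullet> v) / (v \<bullet> v) * v $ j"
proof -
  have "(M ** householder v) $ i $ j =
      (\<Sum>k\<in>UNIV. (if k = j then M $ i $ j else 0) - M $ i $ k * v $ k * (2 / (v \<bullet> v) * v $ j))"
    unfolding matrix_matrix_mult_def vec_lambda_beta householder_def
    by (intro sum.cong) (auto simp: algebra_simps)
  also have "\<dots> = M $ i $ j - (M $ i \<bullet> v) * (2 / (v \<bullet> v) * v $ j)"
    unfolding sum_subtractf sum_distrib_right[symmetric] by (simp add: inner_vec_def[of "M $ i"])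
  finally show ?thesis by (simp add: algebra_simps)
qed

lemma orthogonal_matrix_householder:
  assumes "v \<noteq> 0"
  shows "orthogonal_matrix (householder v)"
proof -
  have v: "v \<bullet> v \<noteq> 0" using assms by simp
  have row: "householder v $ i = axis i 1 - (2 * v $ i / (v \<bullet> v)) *\<^sub>R v" for i
    by (simp add: vec_eq_iff householder_def axis_def)
  have "householder v $ i \<bullet> v = - v $ i" for i
    using v by (simp add: row inner_diff_left inner_axis')
  then have "(householder v ** householder v) $ i $ j = mat 1 $ i $ j" for i j
    by (simp add: mult_householder) (simp add: householder_def mat_def)
  then have "householder v ** householder v = mat 1"
    by (simp add: vec_eq_iff)
  moreover have "Finite_Cartesian_Product.transpose (householder v) = householder v"
    by (auto simp: vec_eq_iff Finite_Cartesian_Product.transpose_def householder_def)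
  ultimately show ?thesis by (simp add: orthogonal_matrix)
qed

text \<open>Once the rows of index below \<open>n\<close> are supported on the diagonal and to the left of it, a
  reflection along a vector supported on the coordinates of index at least \<open>n\<close> leaves them alone; it
  can be chosen to send the tail of the next row to a multiple of a coordinate vector.\<close>

lemma ex_orthogonal_triangularizing_rows:
  fixes g :: "real^'n^'n"
  shows "\<exists>Q. orthogonal_matrix Q \<and> (\<forall>i j. idx i < n \<and> idx i < idx j \<longrightarrow> (g ** Q) $ i $ j = 0)"
proof (induction n)
  case 0
  then show ?case using orthogonal_matrix_id by auto
next
  case (Suc n)
  then obtain Q where Q: "orthogonal_matrix Q"
    and zero: "\<And>i j. idx i < n \<Longrightarrow> idx i < idx j \<Longrightarrow> (g ** Q) $ i $ j = 0" by blast
  show ?case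
  proof (cases "n < CARD('n)")
    case False
    then have "\<And>i :: 'n. idx i < n" using idx_less_card order.strict_trans2 not_less by metis
    then show ?thesis using Q zero by blast
  next
    case True
    then obtain p :: 'n where p: "idx p = n" using ex_idx by blast
    define M where "M = g ** Q"
    define t :: "real^'n" where "t = (\<chi> j. if n \<le> idx j then M $ p $ j else 0)"
    define v where "v = t - axis p (norm t)"
    show ?thesis
    proof (cases "v = 0")
      case True
      then have "t = axis p (norm t)" by (simp add: v_def)
      then have "t $ j = axis p (norm t) $ j" for j by (rule arg_cong)
      then have "t $ j = 0" if "n < idx j" for j
        using that p by (auto simp: axis_def)
      then have "(g ** Q) $ i $ j = 0" if "idx i < Suc n" "idx i < idx j" for i j
      proof (cases "idx i = n")
        case True
        with p have "i = p" using idx_eq_iff by metis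
        with \<open>\<And>j. n < idx j \<Longrightarrow> t $ j = 0\<close>[of j] that True show ?thesis by (simp add: t_def M_def)
      qed (use that zero in auto)
      with Q show ?thesis by blast
    next
      case False
      let ?H = "householder v"
      have Mt: "M $ p \<bullet> v = t \<bullet> v"
        unfolding inner_vec_def
        by (intro sum.cong) (use p in \<open>auto simp: t_def v_def axis_def\<close>)
      \<comment> \<open>This identity is why the reflection sends \<open>t\<close> to \<open>t - v\<close>, a multiple of a coordinate vector.\<close>
      have vv: "v \<bullet> v = 2 * (t \<bullet> v)"
      proof -
        have "axis p (norm t) \<bullet> axis p (norm t) = t \<bullet> t"
          by (simp only: inner_axis_axis) (simp add: dot_square_norm power2_eq_square)
        then show ?thesis
          unfolding v_def inner_diff_left inner_diff_right by (simp add: inner_commute)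
      qed
      have "v \<bullet> v \<noteq> 0" using False by simp
      then have new: "(M ** ?H) $ p $ j = M $ p $ j - v $ j" for j
        using vv by (simp add: mult_householder Mt)
      have old: "(M ** ?H) $ i $ j = M $ i $ j" if "idx i < n" for i j
      proof -
        have "M $ i \<bullet> v = 0"
          unfolding inner_vec_def
          by (intro sum.neutral) (use that p zero in \<open>auto simp: M_def v_def t_def axis_def\<close>)
        then show ?thesis by (simp add: mult_householder)
      qed
      have "(g ** (Q ** ?H)) $ i $ j = 0" if "idx i < Suc n" "idx i < idx j" for i j
      proof (cases "idx i = n")
        case True
        with p have i: "i = p" using idx_eq_iff by metis
        with that p have "v $ j = M $ p $ j" by (auto simp: v_def t_def axis_def)
        then show ?thesis by (simp add: matrix_mul_assoc M_def[symmetric] i new)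
      next
        case False
        with that show ?thesis
          by (simp add: matrix_mul_assoc M_def[symmetric] old) (simp add: M_def zero)
      qed
      moreover have "orthogonal_matrix (Q ** ?H)"
        using Q orthogonal_matrix_householder[OF False] by (rule orthogonal_matrix_mul)
      ultimately show ?thesis by blast
    qed
  qed
qed

definition iwasawa :: "real^'n^'n \<Rightarrow> real^'n^'n \<Rightarrow> real^'n^'n \<Rightarrow> bool" where
  "iwasawa g T Q \<longleftrightarrow>
     g = T ** Q \<and> lower_triangular T \<and> (\<forall>i. 0 < T $ i $ i) \<and> orthogonal_matrix Q"

text \<open>The transpose of a triangularizing orthogonal matrix is the orthogonal factor, up to a diagonal
  matrix of signs that makes the diagonal positive.\<close>

lemma ex_iwasawa:
  fixes g :: "real^'n^'n"
  assumes "det g = 1"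
  obtains T Q where "iwasawa g T Q"
proof -
  obtain Q where Q: "orthogonal_matrix Q"
    and zero: "\<And>i j. idx i < CARD('n) \<Longrightarrow> idx i < idx j \<Longrightarrow> (g ** Q) $ i $ j = 0"
    using ex_orthogonal_triangularizing_rows[of "CARD('n)" g] by blast
  define M where "M = g ** Q"
  have M: "lower_triangular M"
    using zero by (simp add: lower_triangular_def M_def idx_less_card)
  have "det M \<noteq> 0"
    using det_orthogonal_matrix[OF Q] assms by (auto simp: M_def det_mul)
  then have diag: "M $ i $ i \<noteq> 0" for i
    by (simp add: det_lower_triangular[OF M])
  define D :: "real^'n^'n" where "D = (\<chi> i j. if i = j then sgn (M $ i $ i) else 0)"
  have D: "lower_triangular D" by (simp add: lower_triangular_def D_def)
  have DD: "D ** D = mat 1"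
  proof -
    have "(D ** D) $ i $ j = (\<Sum>k\<in>UNIV. if k = i then mat 1 $ i $ j else 0)" for i j
      unfolding matrix_matrix_mult_def vec_lambda_beta
      by (intro sum.cong) (use diag in \<open>auto simp: D_def mat_def sgn_if\<close>)
    then show ?thesis by (simp add: vec_eq_iff)
  qed
  have Dt: "Finite_Cartesian_Product.transpose D = D"
    by (auto simp: vec_eq_iff Finite_Cartesian_Product.transpose_def D_def)
  have orth: "orthogonal_matrix D" by (simp add: orthogonal_matrix Dt DD)
  let ?Q = "D ** Finite_Cartesian_Product.transpose Q"
  have "(M ** D) ** ?Q = M ** (D ** D) ** Finite_Cartesian_Product.transpose Q"
    by (simp add: matrix_mul_assoc)
  also have "\<dots> = g ** (Q ** Finite_Cartesian_Product.transpose Q)"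
    by (simp add: DD M_def matrix_mul_assoc)
  also have "\<dots> = g" using Q by (simp add: orthogonal_matrix_def)
  finally have "g = (M ** D) ** ?Q" by simp
  moreover have "0 < (M ** D) $ i $ i" for i
    using diag[of i] by (simp add: lower_triangular_mult_diag[OF M D]) (auto simp: D_def sgn_if)
  moreover have "orthogonal_matrix ?Q"
    using orth Q by (intro orthogonal_matrix_mul) auto
  ultimately have "iwasawa g (M ** D) ?Q"
    using lower_triangular_mult[OF M D] by (simp add: iwasawa_def)
  with that show ?thesis .
qed

text \<open>The triangular factor is the Cholesky factor of the Gram matrix of the rows, and that is
  determined column by column.\<close>

lemma iwasawa_unique:
  assumes "iwasawa g S P" "iwasawa g T Q"
  shows "S = T"
proof -
  have gram: "g ** Finite_Cartesian_Product.transpose g = S ** Finite_Cartesian_Product.transpose S"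
    if "iwasawa g S P" for S P
  proof -
    have "g ** Finite_Cartesian_Product.transpose g
        = S ** (P ** Finite_Cartesian_Product.transpose P) ** Finite_Cartesian_Product.transpose S"
      using that by (simp add: iwasawa_def matrix_transpose_mul matrix_mul_assoc)
    with that show ?thesis by (simp add: iwasawa_def orthogonal_matrix_def)
  qed
  have entry: "(\<Sum>k\<in>UNIV. S $ i $ k * S $ j $ k) = (\<Sum>k\<in>UNIV. T $ i $ k * T $ j $ k)" for i j
    using gram[OF assms(1)] gram[OF assms(2)]
    by (simp add: vec_eq_iff matrix_matrix_mult_def Finite_Cartesian_Product.transpose_def)
  have split: "(\<Sum>k\<in>UNIV. R $ i $ k * R $ j $ k)
      = R $ i $ j * R $ j $ j + (\<Sum>k | idx k < idx j. R $ i $ k * R $ j $ k)"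
    if "lower_triangular R" for R :: "real^'a^'a" and i j
  proof -
    have "(\<Sum>k\<in>UNIV. R $ i $ k * R $ j $ k) = (\<Sum>k\<in>insert j {k. idx k < idx j}. R $ i $ k * R $ j $ k)"
    proof (rule sum.mono_neutral_right)
      show "\<forall>k\<in>UNIV - insert j {k. idx k < idx j}. R $ i $ k * R $ j $ k = 0"
      proof
        fix k assume "k \<in> UNIV - insert j {k. idx k < idx j}"
        then have "idx j < idx k" by (metis DiffD2 insertCI linorder_neqE_nat mem_Collect_eq idx_eq_iff)
        then show "R $ i $ k * R $ j $ k = 0" using that by (simp add: lower_triangular_def)
      qed
    qed auto
    then show ?thesis by simp
  qed
  have low: "lower_triangular S" "lower_triangular T" and pos: "\<And>i. 0 < S $ i $ i" "\<And>i. 0 < T $ i $ i"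
    using assms by (auto simp: iwasawa_def)
  have "\<forall>i. S $ i $ j = T $ i $ j" for j
  proof (induction "idx j" arbitrary: j rule: less_induct)
    case less
    have rest: "(\<Sum>k | idx k < idx j. S $ i $ k * S $ j $ k) = (\<Sum>k | idx k < idx j. T $ i $ k * T $ j $ k)"
      for i
      using less by (intro sum.cong) auto
    have eq: "S $ i $ j * S $ j $ j = T $ i $ j * T $ j $ j" for i
      using entry[of i j] rest[of i] split[OF low(1), of i j] split[OF low(2), of i j] by simp
    have "(S $ j $ j)\<^sup>2 = (T $ j $ j)\<^sup>2" using eq[of j] by (simp add: power2_eq_square)
    then have diag: "S $ j $ j = T $ j $ j"
      using pos[of j] by (simp add: power2_eq_iff_nonneg less_imp_le)
    show ?case using eq pos(2)[of j] by (simp add: diag)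
  qed
  then show ?thesis by (simp add: vec_eq_iff)
qed

section \<open>Reduction theory\<close>

lemma matrix_mult_entry_bound:
  fixes A B :: "real^'n^'n" and a b :: real
  assumes "\<And>i j. \<bar>A $ i $ j\<bar> \<le> a" "\<And>i j. \<bar>B $ i $ j\<bar> \<le> b"
  shows "\<bar>(A ** B) $ i $ j\<bar> \<le> CARD('n) * (a * b)"
proof -
  have "\<bar>(A ** B) $ i $ j\<bar> \<le> (\<Sum>k\<in>(UNIV :: 'n set). \<bar>A $ i $ k * B $ k $ j\<bar>)"
    unfolding matrix_matrix_mult_def vec_lambda_beta by (rule sum_abs)
  also have "\<dots> \<le> (\<Sum>k\<in>(UNIV :: 'n set). a * b)"
    unfolding abs_mult by (intro sum_mono mult_mono assms) (auto intro: order_trans[OF abs_ge_zero assms(1)])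
  finally show ?thesis by simp
qed

lemma orthogonal_matrix_entry_bound:
  fixes Q :: "real^'n^'n"
  assumes "orthogonal_matrix Q"
  shows "\<bar>Q $ i $ j\<bar> \<le> 1"
  using assms component_le_norm_cart[of "row i Q" j]
  by (simp add: orthogonal_matrix_orthonormal_rows) (simp add: row_def)

text \<open>Adding integer multiples of earlier rows to row \<open>i\<close> corrects its entries from right to left:
  row \<open>p\<close> vanishes to the right of its diagonal entry, so it does not disturb the
  entries that have been treated before. The bound \<open>n\<close> marks how far the correction has proceeded.\<close>

lemma ex_integer_row_reduction:
  fixes T :: "real^'n^'n"
  assumes T: "lower_triangular T" "\<And>i. 0 < T $ i $ i" and "n \<le> idx i"
  shows "\<exists>c. (\<forall>k. c k \<in> \<int>) \<and> (\<forall>k. idx i \<le> idx k \<longrightarrow> c k = 0) \<and>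
    (\<forall>j. n \<le> idx j \<and> idx j < idx i \<longrightarrow> \<bar>T $ i $ j + (\<Sum>k\<in>UNIV. c k * T $ k $ j)\<bar> \<le> T $ j $ j / 2)"
  using assms(3)
proof (induction n rule: inc_induct)
  case base
  show ?case by (rule exI[where x = "\<lambda>_. 0"]) auto
next
  case (step n)
  then obtain c where c: "\<And>k. c k \<in> \<int>" "\<And>k. idx i \<le> idx k \<Longrightarrow> c k = 0"
    and small: "\<And>j. Suc n \<le> idx j \<Longrightarrow> idx j < idx i \<Longrightarrow>
      \<bar>T $ i $ j + (\<Sum>k\<in>UNIV. c k * T $ k $ j)\<bar> \<le> T $ j $ j / 2"
    by blast
  obtain p :: 'n where p: "idx p = n"
    using ex_idx[of n, where 'n='n] idx_less_card[of i] step.hyps by auto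
  define y where "y = (T $ i $ p + (\<Sum>k\<in>UNIV. c k * T $ k $ p)) / T $ p $ p"
  \<comment> \<open>Rounding leaves a remainder of at most one half of the diagonal entry.\<close>
  define c' where "c' = c(p := c p - of_int (round y))"
  have sum': "(\<Sum>k\<in>UNIV. c' k * T $ k $ j) = (\<Sum>k\<in>UNIV. c k * T $ k $ j) - of_int (round y) * T $ p $ j" for j
  proof -
    have "(\<Sum>k\<in>UNIV. c' k * T $ k $ j)
        = (\<Sum>k\<in>UNIV. c k * T $ k $ j - (if k = p then of_int (round y) * T $ p $ j else 0))"
      by (intro sum.cong) (auto simp: c'_def algebra_simps)
    then show ?thesis by (simp add: sum_subtractf)
  qed
  have "\<bar>T $ i $ j + (\<Sum>k\<in>UNIV. c' k * T $ k $ j)\<bar> \<le> T $ j $ j / 2"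
    if "n \<le> idx j" "idx j < idx i" for j
  proof (cases "idx j = n")
    case True
    then have j: "j = p" using p by (metis idx_eq_iff)
    have "T $ i $ j + (\<Sum>k\<in>UNIV. c' k * T $ k $ j) = (y - of_int (round y)) * T $ p $ p"
      using T(2)[of p] by (simp add: sum' j y_def field_simps)
    moreover have "\<bar>y - of_int (round y)\<bar> * T $ p $ p \<le> 1 / 2 * T $ p $ p"
      using of_int_round_abs_le[of y] T(2)[of p] by (intro mult_right_mono) (auto simp: abs_minus_commute)
    ultimately show ?thesis using T(2)[of p] by (simp add: abs_mult j)
  next
    case False
    then have "T $ p $ j = 0" using T(1) p that by (simp add: lower_triangular_def)
    with False that show ?thesis using small[of j] by (simp add: sum')
  qed
  moreover have "c' k \<in> \<int>" "idx i \<le> idx k \<Longrightarrow> c' k = 0" for k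
    using c p step.hyps by (auto simp: c'_def)
  ultimately show ?case by (intro exI[where x = c']) blast
qed

definition size_reduced :: "real^'n^'n \<Rightarrow> bool" where
  "size_reduced T \<longleftrightarrow> (\<forall>i j. idx j < idx i \<longrightarrow> \<bar>T $ i $ j\<bar> \<le> T $ j $ j / 2)"

lemma ex_size_reduction:
  fixes T :: "real^'n^'n"
  assumes T: "lower_triangular T" "\<And>i. 0 < T $ i $ i"
  obtains U where "U \<in> SL_int" "lower_triangular (U ** T)" "\<And>i. (U ** T) $ i $ i = T $ i $ i"
    "size_reduced (U ** T)"
proof -
  have "\<forall>i. \<exists>c. (\<forall>k. c k \<in> \<int>) \<and> (\<forall>k. idx i \<le> idx k \<longrightarrow> c k = 0) \<and>
    (\<forall>j. 0 \<le> idx j \<and> idx j < idx i \<longrightarrow> \<bar>T $ i $ j + (\<Sum>k\<in>UNIV. c k * T $ k $ j)\<bar> \<le> T $ j $ j / 2)"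
    using ex_integer_row_reduction[OF T, of 0] by blast
  from choice[OF this] obtain c where "\<forall>i. (\<forall>k. c i k \<in> \<int>) \<and> (\<forall>k. idx i \<le> idx k \<longrightarrow> c i k = 0) \<and>
    (\<forall>j. 0 \<le> idx j \<and> idx j < idx i \<longrightarrow> \<bar>T $ i $ j + (\<Sum>k\<in>UNIV. c i k * T $ k $ j)\<bar> \<le> T $ j $ j / 2)"
    by blast
  then have c: "\<And>i k. c i k \<in> \<int>" "\<And>i k. idx i \<le> idx k \<Longrightarrow> c i k = 0"
    and small: "\<And>i j. idx j < idx i \<Longrightarrow>
      \<bar>T $ i $ j + (\<Sum>k\<in>UNIV. c i k * T $ k $ j)\<bar> \<le> T $ j $ j / 2"
    by simp_all
  define U :: "real^'n^'n" where "U = (\<chi> i k. c i k + (if k = i then 1 else 0))"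
  have U: "lower_triangular U" "\<And>i. U $ i $ i = 1"
    using c(2) by (auto simp: lower_triangular_def U_def)
  have "U \<in> SL_int"
    using c(1) det_lower_triangular[OF U(1)] U(2) by (auto simp: SL_int_def U_def)
  moreover have diag: "(U ** T) $ i $ i = T $ i $ i" for i
    by (simp add: lower_triangular_mult_diag[OF U(1) T(1)] U(2))
  moreover have "(U ** T) $ i $ j = T $ i $ j + (\<Sum>k\<in>UNIV. c i k * T $ k $ j)" for i j
  proof -
    have "(U ** T) $ i $ j = (\<Sum>k\<in>UNIV. c i k * T $ k $ j + (if k = i then T $ i $ j else 0))"
      unfolding matrix_matrix_mult_def vec_lambda_beta by (intro sum.cong) (auto simp: U_def algebra_simps)
    then show ?thesis by (simp add: sum.distrib)
  qed
  then have "size_reduced (U ** T)"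
    using small by (simp add: size_reduced_def diag)
  ultimately show ?thesis
    using that lower_triangular_mult[OF U(1) T(1)] by blast
qed

lemma iwasawa_size_reduction:
  assumes "iwasawa g T Q"
  obtains U where "U \<in> SL_int" "iwasawa (U ** g) (U ** T) Q" "\<And>i. (U ** T) $ i $ i = T $ i $ i"
    "size_reduced (U ** T)"
proof -
  have T: "lower_triangular T" "\<And>i. 0 < T $ i $ i" using assms by (auto simp: iwasawa_def)
  obtain U where U: "U \<in> SL_int" "lower_triangular (U ** T)" "\<And>i. (U ** T) $ i $ i = T $ i $ i"
    "size_reduced (U ** T)"
    using ex_size_reduction[OF T] by blast
  with assms have "iwasawa (U ** g) (U ** T) Q" by (simp add: iwasawa_def matrix_mul_assoc)
  with U that show ?thesis by blast
qed

text \<open>The weights decrease fast enough for the exchange of two badly ordered rows to lower the sum, and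
  they are positive, so that a bound on the sum bounds every diagonal entry.\<close>

definition energy :: "real^'n^'n \<Rightarrow> real" where
  "energy T = (\<Sum>i\<in>UNIV. (1 / 4) ^ idx i * (T $ i $ i)\<^sup>2)"

text \<open>Size reduction changes \<open>\<gamma>\<close> but not the diagonal of \<open>T\<close>. Afterwards all the entries of \<open>T\<close> are
  bounded in terms of the energy, hence so are those of \<open>\<gamma> = T Q g\<^sup>-\<^sup>1\<close>; and \<open>T\<close> is determined by
  \<open>\<gamma>\<close>.\<close>

lemma finite_energy_below:
  fixes g :: "real^'n^'n"
  assumes g: "det g = 1"
  shows "finite {energy T | T \<gamma> Q. \<gamma> \<in> SL_int \<and> iwasawa (\<gamma> ** g) T Q \<and> energy T \<le> e}"
proof -
  obtain h where h: "g ** h = mat 1" using SL_inverse[OF g] by blast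
  define b where "b = sqrt (4 ^ CARD('n) * \<bar>e\<bar>)"
  define R where "R = CARD('n) * (CARD('n) * (b * 1) * norm h)"
  let ?f = "\<lambda>\<gamma>. energy (THE T. \<exists>Q. iwasawa (\<gamma> ** g) T Q)"
  let ?B = "{\<gamma> :: real^'n^'n. \<gamma> \<in> SL_int \<and> (\<forall>i j. \<bar>\<gamma> $ i $ j\<bar> \<le> R)}"
  have "energy T \<in> ?f ` ?B"
    if \<gamma>: "\<gamma> \<in> SL_int" and T: "iwasawa (\<gamma> ** g) T Q" and le: "energy T \<le> e" for T \<gamma> Q
  proof -
    obtain U where U: "U \<in> SL_int" "iwasawa (U ** (\<gamma> ** g)) (U ** T) Q"
      "\<And>i. (U ** T) $ i $ i = T $ i $ i" "size_reduced (U ** T)"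
      using iwasawa_size_reduction[OF T] by blast
    have pos: "0 < T $ i $ i" for i using T by (simp add: iwasawa_def)
    have diag: "T $ i $ i \<le> b" for i
    proof -
      have "(1 / 4) ^ idx i * (T $ i $ i)\<^sup>2 \<le> energy T"
        unfolding energy_def by (rule member_le_sum) auto
      then have "(1 / 4) ^ idx i * (T $ i $ i)\<^sup>2 \<le> \<bar>e\<bar>" using le by linarith
      then have "4 ^ idx i * ((1 / 4) ^ idx i * (T $ i $ i)\<^sup>2) \<le> 4 ^ idx i * \<bar>e\<bar>"
        by (intro mult_left_mono) auto
      moreover have "4 ^ idx i * ((1 / 4) ^ idx i * (T $ i $ i)\<^sup>2) = (T $ i $ i)\<^sup>2"
        by (simp add: power_one_over)
      ultimately have "(T $ i $ i)\<^sup>2 \<le> 4 ^ idx i * \<bar>e\<bar>" by simp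
      also have "\<dots> \<le> 4 ^ CARD('n) * \<bar>e\<bar>"
        using idx_less_card[of i] by (intro mult_right_mono power_increasing) auto
      finally show ?thesis unfolding b_def by (rule real_le_rsqrt)
    qed
    have entry: "\<bar>(U ** T) $ i $ j\<bar> \<le> b" for i j
    proof -
      consider "i = j" | "idx i < idx j" | "idx j < idx i" by (metis linorder_neqE_nat idx_eq_iff)
      then show ?thesis
      proof cases
        case 1
        then show ?thesis using U(3) pos[of j] diag[of j] by simp
      next
        case 2
        then have "(U ** T) $ i $ j = 0" using U(2) by (simp add: iwasawa_def lower_triangular_def)
        then show ?thesis using pos[of j] diag[of j] by simp
      next
        case 3
        then have "\<bar>(U ** T) $ i $ j\<bar> \<le> T $ j $ j / 2" using U(3,4) by (simp add: size_reduced_def)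
        then show ?thesis using pos[of j] diag[of j] by simp
      qed
    qed
    have "U ** \<gamma> = (U ** T) ** Q ** h"
    proof -
      have "U ** \<gamma> = (U ** (\<gamma> ** g)) ** h"
        using h by (simp add: matrix_mul_assoc[symmetric])
      then show ?thesis using U(2) by (simp add: iwasawa_def)
    qed
    moreover have "\<bar>(U ** T ** Q ** h) $ i $ j\<bar> \<le> R" for i j
      unfolding R_def
    proof (intro matrix_mult_entry_bound entry)
      show "\<And>i j. \<bar>Q $ i $ j\<bar> \<le> 1"
        using U(2) by (auto simp: iwasawa_def intro: orthogonal_matrix_entry_bound)
      show "\<And>i j. \<bar>h $ i $ j\<bar> \<le> norm h"
        using entry_dist_le[of h _ _ 0] by simp
    qed
    ultimately have mem: "U ** \<gamma> \<in> ?B" using SL_int_mult[OF U(1) \<gamma>] by simp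
    have "(THE T. \<exists>Q. iwasawa ((U ** \<gamma>) ** g) T Q) = U ** T"
      using U(2) iwasawa_unique unfolding matrix_mul_assoc by blast
    then have "energy T = ?f (U ** \<gamma>)" by (simp add: energy_def U(3))
    then show ?thesis using mem by (rule image_eqI)
  qed
  then have "{energy T | T \<gamma> Q. \<gamma> \<in> SL_int \<and> iwasawa (\<gamma> ** g) T Q \<and> energy T \<le> e} \<subseteq> ?f ` ?B"
    by blast
  then show ?thesis
    using finite_imageI[OF finite_bounded_SL_int[of R], of ?f] by (rule finite_subset)
qed

text \<open>Interchanging two consecutive rows up to sign, and then rotating the corresponding two
  columns to restore the triangular shape, changes the two diagonal entries \<open>x\<close>, \<open>y\<close> into
  \<open>r\<close>, \<open>x y / r\<close>, where \<open>r\<close> is the length of the second row's tail. If \<open>x > 2 y\<close> then, by size reduction,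
  \<open>r\<^sup>2 < x\<^sup>2 / 2\<close> and the second new entry is at most \<open>x\<close>, and the ratio \<open>1/4\<close> of the weights
  makes the energy drop.\<close>

lemma energy_decrease_by_swap:
  fixes g :: "real^'n^'n"
  assumes iw: "iwasawa g T Q" and "size_reduced T"
    and ij: "idx j = Suc (idx i)" and large: "2 * T $ j $ j < T $ i $ i"
  obtains S P where "iwasawa (rot i j 0 (- 1) ** g) S P" "energy S < energy T"
proof -
  define x y z where "x = T $ i $ i" and "y = T $ j $ j" and "z = T $ j $ i"
  define r where "r = sqrt (z\<^sup>2 + y\<^sup>2)"
  have T: "lower_triangular T" "\<And>i. 0 < T $ i $ i" "orthogonal_matrix Q" "g = T ** Q"
    using iw by (auto simp: iwasawa_def)
  have ne: "i \<noteq> j" using ij by auto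
  have pos: "0 < x" "0 < y" using T(2) by (auto simp: x_def y_def)
  have z: "\<bar>z\<bar> \<le> x / 2"
    using \<open>size_reduced T\<close> ij by (simp add: size_reduced_def x_def z_def)
  have r2: "r\<^sup>2 = z\<^sup>2 + y\<^sup>2" by (simp add: r_def)
  have r: "0 < r" using pos by (simp add: r_def add_nonneg_pos)
  have Tij: "T $ i $ j = 0" using T(1) ij by (simp add: lower_triangular_def)
  \<comment> \<open>The rotation turns the tail \<open>(z, y)\<close> of row \<open>j\<close> into \<open>(r, 0)\<close>.\<close>
  define G where "G = rot i j (z / r) (y / r)"
  have G: "orthogonal_matrix G"
    unfolding G_def using r
    by (intro orthogonal_matrix_rot ne) (simp add: power_divide add_divide_distrib[symmetric] r2[symmetric])
  define S where "S = rot i j 0 (- 1) ** T ** G"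
  have S: "S $ a $ b =
      (let M = (\<lambda>b. if a = i then T $ j $ b else if a = j then - T $ i $ b else T $ a $ b) in
       if b = i then (z * M i + y * M j) / r
       else if b = j then (z * M j - y * M i) / r else M b)" for a b
    using ne by (simp add: S_def G_def mult_rot_right mult_rot_left Let_def add_divide_distrib diff_divide_distrib)
  have low: "lower_triangular S"
    unfolding lower_triangular_def
  proof (intro allI impI)
    fix a b :: 'n assume ab: "idx a < idx b"
    have zero: "T $ c $ d = 0" if "idx c < idx d" for c d
      using that T(1) by (simp add: lower_triangular_def)
    consider "b = i" | "b = j" "a = i" | "b = j" "a \<noteq> i" "idx a < idx i" | "b \<noteq> i" "b \<noteq> j"
      using ab ij by (metis less_SucE idx_eq_iff)
    then show "S $ a $ b = 0"
    proof cases
      case 1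
      then show ?thesis using ab ij ne by (auto simp: S Let_def zero)
    next
      case 2
      then show ?thesis using ne by (simp add: S Let_def y_def z_def mult.commute)
    next
      case 3
      then show ?thesis using ab ij ne by (auto simp: S Let_def zero)
    next
      case 4
      then have "idx j < idx b" if "a = i" using that ab ij by (metis Suc_lessI idx_eq_iff)
      with 4 ab ij show ?thesis by (auto simp: S Let_def zero)
    qed
  qed
  have Sii: "S $ i $ i = r"
    using r r2 ne by (simp add: S Let_def y_def[symmetric] z_def[symmetric] power2_eq_square field_simps)
  have Sjj: "S $ j $ j = x * y / r"
    using ne Tij by (simp add: S Let_def x_def)
  have Saa: "S $ a $ a = T $ a $ a" if "a \<noteq> i" "a \<noteq> j" for a
    using that by (simp add: S Let_def)
  have "0 < S $ a $ a" for a
    using Sii Sjj Saa r pos T(2) by (cases "a = i"; cases "a = j") simp_all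
  moreover have "orthogonal_matrix (Finite_Cartesian_Product.transpose G ** Q)"
    using G T(3) by (intro orthogonal_matrix_mul) auto
  moreover have "rot i j 0 (- 1) ** g = S ** (Finite_Cartesian_Product.transpose G ** Q)"
  proof -
    have "S ** (Finite_Cartesian_Product.transpose G ** Q)
        = rot i j 0 (- 1) ** T ** (G ** Finite_Cartesian_Product.transpose G) ** Q"
      by (simp add: S_def matrix_mul_assoc)
    also have "\<dots> = rot i j 0 (- 1) ** g"
      using G by (simp add: orthogonal_matrix_def T(4) matrix_mul_assoc)
    finally show ?thesis by simp
  qed
  ultimately have "iwasawa (rot i j 0 (- 1) ** g) S (Finite_Cartesian_Product.transpose G ** Q)"
    using low by (simp add: iwasawa_def)
  moreover have "energy S < energy T"
  proof -
    define w :: real where "w = (1 / 4) ^ idx i"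
    have w: "0 < w" by (simp add: w_def)
    have split: "energy M = w * ((M $ i $ i)\<^sup>2 + (M $ j $ j)\<^sup>2 / 4)
        + (\<Sum>a\<in>UNIV - {i, j}. (1 / 4) ^ idx a * (M $ a $ a)\<^sup>2)" for M :: "real^'n^'n"
      unfolding energy_def using ne
      by (subst sum.subset_diff[of "{i, j}"]) (auto simp: ij w_def algebra_simps)
    have "4 * z\<^sup>2 \<le> x\<^sup>2"
      using power_mono[OF z, of 2] by (simp add: power_divide)
    moreover have "4 * y\<^sup>2 < x\<^sup>2"
      using power_strict_mono[of "2 * y" x 2] large pos by (simp add: x_def y_def power_mult_distrib)
    moreover have "(x * y / r)\<^sup>2 \<le> x\<^sup>2"
    proof -
      have "y \<le> r" unfolding r_def by (rule real_le_rsqrt) simp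
      then have "x * y / r \<le> x" using r pos by (simp add: field_simps)
      then show ?thesis using pos r by (intro power_mono) auto
    qed
    moreover have "0 < y\<^sup>2" using pos by simp
    ultimately have "r\<^sup>2 + (x * y / r)\<^sup>2 / 4 < x\<^sup>2 + y\<^sup>2 / 4"
      by (simp only: r2)
    then have "w * (r\<^sup>2 + (x * y / r)\<^sup>2 / 4) < w * (x\<^sup>2 + y\<^sup>2 / 4)"
      using w by simp
    moreover have "(\<Sum>a\<in>UNIV - {i, j}. (1 / 4) ^ idx a * (S $ a $ a)\<^sup>2)
        = (\<Sum>a\<in>UNIV - {i, j}. (1 / 4) ^ idx a * (T $ a $ a)\<^sup>2)"
      by (intro sum.cong) (auto simp: Saa)
    ultimately show ?thesis
      unfolding split by (simp add: Sii Sjj x_def y_def)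
  qed
  ultimately show ?thesis by (rule that)
qed

text \<open>Take a minimiser of the energy on the orbit of \<open>g\<close> and size reduce it.\<close>

theorem ex_reduced_representative:
  fixes g :: "real^'n^'n"
  assumes g: "det g = 1"
  obtains \<gamma> T Q where "\<gamma> \<in> SL_int" "iwasawa (\<gamma> ** g) T Q" "size_reduced T"
    "\<And>i j. idx j = Suc (idx i) \<Longrightarrow> T $ i $ i \<le> 2 * T $ j $ j"
proof -
  define V where "V e = {energy T | T \<gamma> Q. \<gamma> \<in> SL_int \<and> iwasawa (\<gamma> ** g) T Q \<and> energy T \<le> e}" for e
  obtain T0 Q0 where "iwasawa g T0 Q0" using ex_iwasawa[OF g] .
  then have T0: "iwasawa (mat 1 ** g) T0 Q0" by simp
  have fin: "finite (V (energy T0))" unfolding V_def by (rule finite_energy_below[OF g])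
  have "energy T0 \<in> V (energy T0)" using T0 mat_1_SL_int unfolding V_def by blast
  then have "Min (V (energy T0)) \<in> V (energy T0)" using fin by (intro Min_in) auto
  then obtain \<gamma> T Q where T: "\<gamma> \<in> SL_int" "iwasawa (\<gamma> ** g) T Q" "energy T \<le> energy T0"
    and min: "energy T = Min (V (energy T0))" by (auto simp: V_def)
  have least: "energy T \<le> energy S" if "\<delta> \<in> SL_int" "iwasawa (\<delta> ** g) S P" for \<delta> S P
  proof (cases "energy S \<le> energy T0")
    case True
    then have "energy S \<in> V (energy T0)" using that by (auto simp: V_def)
    then show ?thesis using fin min by simp
  qed (use T in simp)
  obtain U where U: "U \<in> SL_int" "iwasawa (U ** (\<gamma> ** g)) (U ** T) Q"
    "\<And>i. (U ** T) $ i $ i = T $ i $ i" "size_reduced (U ** T)"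
    using iwasawa_size_reduction[OF T(2)] by blast
  have same: "energy (U ** T) = energy T" by (simp add: energy_def U(3))
  have "(U ** T) $ i $ i \<le> 2 * (U ** T) $ j $ j" if ij: "idx j = Suc (idx i)" for i j
  proof (rule ccontr)
    assume "\<not> ?thesis"
    then have "2 * (U ** T) $ j $ j < (U ** T) $ i $ i" by simp
    from energy_decrease_by_swap[OF U(2,4) ij this]
    obtain S P where S: "iwasawa (rot i j 0 (- 1) ** (U ** (\<gamma> ** g))) S P"
      and "energy S < energy (U ** T)"
      .
    moreover have "rot i j 0 (- 1) ** (U ** \<gamma>) \<in> SL_int"
      using ij U(1) T(1) by (intro SL_int_mult SL_int_quarter_turn) auto
    ultimately show False
      using least[of "rot i j 0 (- 1) ** (U ** \<gamma>)" S P] same by (simp add: matrix_mul_assoc)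
  qed
  with that[OF SL_int_mult[OF U(1) T(1)] _ U(4)] U(2) show ?thesis
    by (simp add: matrix_mul_assoc)
qed

section \<open>Lebesgue measure under left multiplication of matrices\<close>

lemma nn_integral_lborel_plus:
  fixes f :: "'a::euclidean_space \<Rightarrow> ennreal"
  assumes "f \<in> borel_measurable borel"
  shows "(\<integral>\<^sup>+y. f (y + c) \<partial>lborel) = (\<integral>\<^sup>+y. f y \<partial>lborel)"
proof -
  have "(\<integral>\<^sup>+y. f y \<partial>lborel) = (\<integral>\<^sup>+y. f y \<partial>distr lborel borel ((+) c))"
    by (simp only: lborel_distr_plus)
  also have "\<dots> = (\<integral>\<^sup>+y. f (c + y) \<partial>lborel)"
    using assms by (intro nn_integral_distr) auto
  finally show ?thesis by (simp add: add.commute)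
qed

lemma nn_integral_lborel_reflect:
  fixes f :: "'a::euclidean_space \<Rightarrow> ennreal"
  assumes "f \<in> borel_measurable borel"
  shows "(\<integral>\<^sup>+y. f (c - y) \<partial>lborel) = (\<integral>\<^sup>+y. f y \<partial>lborel)"
proof -
  have "(lborel :: 'a measure) = distr lborel borel (\<lambda>y. c - y)"
    using lborel_affine[of "-1" c] by (simp add: density_1)
  then have "(\<integral>\<^sup>+y. f y \<partial>lborel) = (\<integral>\<^sup>+y. f y \<partial>distr lborel borel (\<lambda>y. c - y))"
    by simp
  also have "\<dots> = (\<integral>\<^sup>+y. f (c - y) \<partial>lborel)"
    using assms by (intro nn_integral_distr) auto
  finally show ?thesis by simp
qed

text \<open>The pullback of Lebesgue measure under an invertible linear map is again translation
  invariant. Both sides below evaluate the double integral of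
  \<open>1\<^sub>A(x) 1\<^sub>B(f y - x)\<close>: translating \<open>y\<close> gives the left one, reflecting and translating \<open>x\<close> the
  right one.\<close>

lemma lborel_linear_vimage_cross:
  fixes f :: "'a::euclidean_space \<Rightarrow> 'a"
  assumes "linear f" "surj f" and [measurable]: "A \<in> sets borel" "B \<in> sets borel"
  shows "emeasure lborel A * emeasure lborel (f -` B) = emeasure lborel (f -` A) * emeasure lborel B"
proof -
  have [measurable]: "f \<in> borel_measurable borel"
    using \<open>linear f\<close> by (intro borel_measurable_continuous_onI linear_continuous_on)
      (simp add: linear_conv_bounded_linear)
  have vim: "(\<integral>\<^sup>+y. indicator X (f y) \<partial>lborel) = emeasure lborel (f -` X)"
    if [measurable]: "X \<in> sets borel" for X
  proof -
    have "f -` X \<in> sets lborel" using measurable_sets[of f borel borel X] by simp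
    moreover have "(\<lambda>y. indicator X (f y) :: ennreal) = indicator (f -` X)"
      by (auto simp: indicator_def)
    ultimately show ?thesis by simp
  qed
  have "emeasure lborel A * emeasure lborel (f -` B)
      = (\<integral>\<^sup>+x. indicator A x * (\<integral>\<^sup>+y. indicator B (f y) \<partial>lborel) \<partial>lborel)"
    by (simp add: vim nn_integral_multc)
  also have "\<dots> = (\<integral>\<^sup>+x. \<integral>\<^sup>+y. indicator A x * indicator B (f y - x) \<partial>lborel \<partial>lborel)"
  proof (rule nn_integral_cong)
    fix x
    obtain w where w: "x = f w" using \<open>surj f\<close> by blast
    have "(\<integral>\<^sup>+y. indicator B (f y) \<partial>lborel) = (\<integral>\<^sup>+y. indicator B (f (y + (- w))) \<partial>lborel)"
      by (subst nn_integral_lborel_plus[where f = "\<lambda>y. indicator B (f y)"]) simp_all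
    also have "\<dots> = (\<integral>\<^sup>+y. indicator B (f y - x) \<partial>lborel)"
      using \<open>linear f\<close> by (simp add: w linear_diff)
    finally show "indicator A x * (\<integral>\<^sup>+y. indicator B (f y) \<partial>lborel)
        = (\<integral>\<^sup>+y. indicator A x * indicator B (f y - x) \<partial>lborel)"
      by (simp add: nn_integral_cmult)
  qed
  also have "\<dots> = (\<integral>\<^sup>+y. \<integral>\<^sup>+x. indicator A x * indicator B (f y - x) \<partial>lborel \<partial>lborel)"
    by (rule lborel_pair.Fubini'[symmetric]) measurable
  also have "\<dots> = (\<integral>\<^sup>+y. \<integral>\<^sup>+x. indicator A (f y - x) * indicator B x \<partial>lborel \<partial>lborel)"
  proof (rule nn_integral_cong)
    fix y
    show "(\<integral>\<^sup>+x. indicator A x * indicator B (f y - x) \<partial>lborel)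
        = (\<integral>\<^sup>+x. indicator A (f y - x) * (indicator B x :: ennreal) \<partial>lborel)"
      using nn_integral_lborel_reflect[of "\<lambda>x. indicator A (f y - x) * indicator B x" "f y"] by simp
  qed
  also have "\<dots> = (\<integral>\<^sup>+x. \<integral>\<^sup>+y. indicator A (f y - x) * indicator B x \<partial>lborel \<partial>lborel)"
    by (rule lborel_pair.Fubini') measurable
  also have "\<dots> = (\<integral>\<^sup>+x. (\<integral>\<^sup>+y. indicator A (f y) \<partial>lborel) * indicator B x \<partial>lborel)"
  proof (rule nn_integral_cong)
    fix x
    obtain w where w: "x = f w" using \<open>surj f\<close> by blast
    have "(\<integral>\<^sup>+y. indicator A (f y) \<partial>lborel) = (\<integral>\<^sup>+y. indicator A (f (y + (- w))) \<partial>lborel)"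
      by (subst nn_integral_lborel_plus[where f = "\<lambda>y. indicator A (f y)"]) simp_all
    also have "\<dots> = (\<integral>\<^sup>+y. indicator A (f y - x) \<partial>lborel)"
      using \<open>linear f\<close> by (simp add: w linear_diff)
    finally show "(\<integral>\<^sup>+y. indicator A (f y - x) * indicator B x \<partial>lborel)
        = (\<integral>\<^sup>+y. indicator A (f y) \<partial>lborel) * indicator B x"
      by (simp add: nn_integral_multc)
  qed
  also have "\<dots> = emeasure lborel (f -` A) * emeasure lborel B"
    by (simp add: vim nn_integral_cmult)
  finally show ?thesis .
qed

lemma linear_matrix_mult_left: "linear (\<lambda>M :: real^'m^'n. A ** M)"
  by (rule linearI) (simp_all add: matrix_add_ldistrib vec_eq_iff matrix_matrix_mult_def
      sum_distrib_left sum.distrib algebra_simps)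

lemma continuous_on_matrix_mult_left: "continuous_on S (\<lambda>M :: real^'m^'n. A ** M)"
  by (intro linear_continuous_on linear_conv_bounded_linear[THEN iffD1] linear_matrix_mult_left)

lemma surj_matrix_mult_left:
  fixes A :: "real^'n^'n"
  assumes "det A \<noteq> 0"
  shows "surj (\<lambda>M :: real^'m^'n. A ** M)"
proof -
  obtain B where "A ** B = mat 1"
    using assms invertible_det_nz[of A] by (auto simp: invertible_def)
  then have "M = A ** (B ** M)" for M :: "real^'m^'n"
    by (simp add: matrix_mul_assoc)
  then show ?thesis by (rule surjI[OF sym])
qed

definition left_scaling :: "real^'n^'n \<Rightarrow> real \<Rightarrow> bool" where
  "left_scaling A c \<longleftrightarrow> 0 < c \<and>
     (\<forall>X\<in>sets borel. emeasure lborel ((\<lambda>M :: real^'n^'n. A ** M) -` X) = ennreal c * emeasure lborel X)"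

lemma emeasure_lborel_open_nonzero:
  fixes U :: "'a::euclidean_space set"
  assumes "open U" "U \<noteq> {}"
  shows "emeasure lborel U \<noteq> 0"
proof
  assume "emeasure lborel U = 0"
  then have "U \<in> null_sets lborel" using assms(1) by (auto simp: null_sets_def)
  then have "negligible U"
    unfolding negligible_iff_null_sets by (rule null_sets_completionI)
  with assms show False using open_not_negligible by blast
qed

lemma lborel_unit_ball:
  "0 < emeasure lborel (ball 0 1 :: 'a::euclidean_space set)"
  "emeasure lborel (ball 0 1 :: 'a::euclidean_space set) < \<infinity>"
proof -
  show "emeasure lborel (ball 0 1 :: 'a set) < \<infinity>"
    by (rule emeasure_bounded_finite) simp
  show "0 < emeasure lborel (ball 0 1 :: 'a set)"
    using emeasure_lborel_open_nonzero[of "ball 0 1 :: 'a set"] by (simp add: zero_less_iff_neq_zero)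
qed

text \<open>Fixing one of the two sets in the cross relation to be the unit ball exhibits the
  factor.\<close>

lemma ex_left_scaling:
  fixes A :: "real^'n^'n"
  assumes "det A \<noteq> 0"
  shows "\<exists>c. left_scaling A c"
proof -
  let ?f = "\<lambda>M :: real^'n^'n. A ** M" and ?b = "ball 0 1 :: (real^'n^'n) set"
  have lin: "linear ?f" by (rule linear_matrix_mult_left)
  have surj: "surj ?f" by (rule surj_matrix_mult_left[OF assms])
  have cross: "emeasure lborel ?b * emeasure lborel (?f -` X) = emeasure lborel (?f -` ?b) * emeasure lborel X"
    if "X \<in> sets borel" for X
    using that by (intro lborel_linear_vimage_cross[OF lin surj]) auto
  obtain b where b: "emeasure lborel ?b = ennreal b" "0 < b"
    using lborel_unit_ball[where 'a = "real^'n^'n"]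
    by (cases "emeasure lborel ?b") auto
  have "open (?f -` ?b)"
    by (intro open_vimage continuous_on_matrix_mult_left) simp
  moreover have "0 \<in> ?f -` ?b" by (simp add: linear_0[OF lin])
  ultimately have "emeasure lborel (?f -` ?b) \<noteq> 0"
    using emeasure_lborel_open_nonzero[of "?f -` ?b"] by blast
  moreover have "emeasure lborel (?f -` ?b) < \<infinity>"
  proof -
    obtain B where B: "B ** A = mat 1"
      using assms invertible_det_nz[of A] by (auto simp: invertible_def)
    have "M = B ** (A ** M)" for M :: "real^'n^'n"
      by (simp add: matrix_mul_assoc B)
    then have "?f -` ?b \<subseteq> (\<lambda>M. B ** M) ` ?b" by blast
    moreover have "bounded ((\<lambda>M :: real^'n^'n. B ** M) ` ?b)"
      by (intro bounded_linear_image bounded_ball linear_conv_bounded_linear[THEN iffD1]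
          linear_matrix_mult_left)
    ultimately show ?thesis by (intro emeasure_bounded_finite) (rule bounded_subset)
  qed
  ultimately obtain a where a: "emeasure lborel (?f -` ?b) = ennreal a" "0 < a"
    by (cases "emeasure lborel (?f -` ?b)") auto
  have "emeasure lborel (?f -` X) = ennreal (a / b) * emeasure lborel X" if "X \<in> sets borel" for X
  proof -
    have "ennreal (1 / b) * (ennreal b * emeasure lborel (?f -` X))
        = ennreal (1 / b) * (ennreal a * emeasure lborel X)"
      using cross[OF that] a b by simp
    then show ?thesis
      using a b by (simp add: mult.assoc[symmetric] ennreal_mult[symmetric])
  qed
  then have "left_scaling A (a / b)" using a b by (simp add: left_scaling_def)
  then show ?thesis by blast
qed

lemma left_scaling_unique:
  assumes "left_scaling A c" "left_scaling A c'"
  shows "c = c'"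
proof -
  obtain b where b: "emeasure lborel (ball 0 1 :: (real^'a^'a) set) = ennreal b" "0 < b"
    using lborel_unit_ball[where 'a = "real^'a^'a"]
    by (cases "emeasure lborel (ball 0 1 :: (real^'a^'a) set)") auto
  have "ennreal c * ennreal b = ennreal c' * ennreal b"
    using assms b(1) unfolding left_scaling_def by (metis borel_open open_ball)
  then have "c * b = c' * b"
    using assms b(2) by (simp add: left_scaling_def ennreal_mult[symmetric])
  then show ?thesis using b(2) by simp
qed

lemma left_scaling_mult:
  fixes A B :: "real^'n^'n"
  assumes "left_scaling A a" "left_scaling B b"
  shows "left_scaling (A ** B) (a * b)"
  unfolding left_scaling_def
proof (intro conjI ballI)
  show "0 < a * b" using assms by (simp add: left_scaling_def)
  fix X :: "(real^'n^'n) set" assume X: "X \<in> sets borel"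
  have "(\<lambda>M :: real^'n^'n. A ** M) -` X \<in> sets borel"
    using measurable_sets[OF borel_measurable_continuous_onI[OF continuous_on_matrix_mult_left] X] by simp
  moreover have "(\<lambda>M. (A ** B) ** M) -` X = (\<lambda>M. B ** M) -` ((\<lambda>M. A ** M) -` X)"
    by (auto simp: matrix_mul_assoc)
  ultimately show "emeasure lborel ((\<lambda>M. (A ** B) ** M) -` X) = ennreal (a * b) * emeasure lborel X"
    using assms X by (simp add: left_scaling_def ennreal_mult mult_ac)
qed

text \<open>A diagonal matrix acts diagonally on the standard basis of the space of matrices, and each of its
  entries occurs there once for each column.\<close>

lemma left_scaling_diagonal:
  fixes D :: "real^'n^'n"
  assumes diag: "\<And>i j. i \<noteq> j \<Longrightarrow> D $ i $ j = 0" and "det D \<noteq> 0"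
  shows "left_scaling D (1 / \<bar>det D\<bar> ^ CARD('n))"
proof -
  obtain c where c: "left_scaling D c" using ex_left_scaling[OF assms(2)] by blast
  have det: "det D = (\<Prod>i\<in>UNIV. D $ i $ i)" by (rule det_diagonal[OF diag])
  then have nz: "D $ i $ i \<noteq> 0" for i using assms(2) by auto
  have entry: "(D ** M) $ i $ j = D $ i $ i * M $ i $ j" for M :: "real^'n^'n" and i j
  proof -
    have "(D ** M) $ i $ j = (\<Sum>k\<in>UNIV. if k = i then D $ i $ i * M $ i $ j else 0)"
      unfolding matrix_matrix_mult_def vec_lambda_beta by (intro sum.cong) (auto simp: diag)
    then show ?thesis by simp
  qed
  define d :: "real^'n^'n \<Rightarrow> real" where "d b = (D ** b) \<bullet> b" for b
  have d: "d (axis i (axis j 1)) = D $ i $ i" for i j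
    by (simp add: d_def inner_axis entry) 
  have Basis: "(Basis :: (real^'n^'n) set) = (\<lambda>(i, j). axis i (axis j 1)) ` UNIV"
    by (auto simp: Basis_vec_def)
  have inj: "inj (\<lambda>(i, j). axis i (axis j 1) :: real^'n^'n)"
    by (auto simp: inj_def axis_eq_axis)
  have T: "(\<Sum>b\<in>Basis. (d b * (M \<bullet> b)) *\<^sub>R b) = D ** M" for M
  proof (rule euclidean_eqI)
    fix b :: "real^'n^'n" assume b: "b \<in> Basis"
    then obtain i j where "b = axis i (axis j 1)" by (auto simp: Basis)
    then have "(D ** M) \<bullet> b = d b * (M \<bullet> b)" by (simp add: d inner_axis entry)
    with b show "(\<Sum>b\<in>Basis. (d b * (M \<bullet> b)) *\<^sub>R b) \<bullet> b = (D ** M) \<bullet> b" by simp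
  qed
  have "(\<Prod>b\<in>(Basis :: (real^'n^'n) set). \<bar>d b\<bar>) = (\<Prod>(i, j)\<in>(UNIV :: ('n \<times> 'n) set). \<bar>D $ i $ i\<bar>)"
    unfolding Basis by (subst prod.reindex[OF inj]) (simp add: case_prod_beta d)
  also have "\<dots> = (\<Prod>i\<in>UNIV. \<Prod>j\<in>(UNIV :: 'n set). \<bar>D $ i $ i\<bar>)"
    by (subst UNIV_Times_UNIV[symmetric], subst prod.cartesian_product) (rule refl)
  also have "\<dots> = \<bar>det D\<bar> ^ CARD('n)"
    by (simp add: det abs_prod prod_power_distrib)
  finally have p: "(\<Prod>b\<in>(Basis :: (real^'n^'n) set). \<bar>d b\<bar>) = \<bar>det D\<bar> ^ CARD('n)" .
  have "d b \<noteq> 0" if "b \<in> Basis" for b using that nz by (auto simp: Basis d)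
  then have eq: "(lborel :: (real^'n^'n) measure) = density (distr lborel borel (\<lambda>M. D ** M)) (\<lambda>_. ennreal (\<bar>det D\<bar> ^ CARD('n)))"
    using lborel_affine_euclidean[of d 0] by (simp add: T p)
  let ?b = "ball 0 1 :: (real^'n^'n) set"
  obtain b where b: "emeasure lborel ?b = ennreal b" "0 < b"
    using lborel_unit_ball[where 'a = "real^'n^'n"] by (cases "emeasure lborel ?b") auto
  have "emeasure lborel ?b = ennreal (\<bar>det D\<bar> ^ CARD('n)) * emeasure (distr lborel borel (\<lambda>M. D ** M)) ?b"
    by (subst eq) (simp add: emeasure_density_const)
  also have "emeasure (distr lborel borel (\<lambda>M. D ** M)) ?b = emeasure lborel ((\<lambda>M. D ** M) -` ?b)"
    by (subst emeasure_distr) (auto intro!: borel_measurable_continuous_onI continuous_on_matrix_mult_left)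
  also have "\<dots> = ennreal c * emeasure lborel ?b" using c by (simp add: left_scaling_def)
  finally have "ennreal b = ennreal (\<bar>det D\<bar> ^ CARD('n) * (c * b))"
    using b c by (simp add: left_scaling_def ennreal_mult)
  then have "b = \<bar>det D\<bar> ^ CARD('n) * (c * b)"
    using b c by (subst (asm) ennreal_inj) (auto simp: left_scaling_def)
  then have "c = 1 / \<bar>det D\<bar> ^ CARD('n)" using b(2) assms(2) by (simp add: field_simps)
  with c show ?thesis by simp
qed

text \<open>The scaling factor is multiplicative. A transposition is an involution, and a shear is
  conjugate to its own square by a diagonal matrix; this forces the value one on both of them.\<close>

lemma left_scaling_det:
  fixes A :: "real^'n^'n"
  assumes "det A \<noteq> 0"
  shows "left_scaling A (1 / \<bar>det A\<bar> ^ CARD('n))"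
proof -
  have "det A \<noteq> 0 \<longrightarrow> left_scaling A (1 / \<bar>det A\<bar> ^ CARD('n))"
  proof (induction A rule: induct_matrix_elementary)
    case (1 A B)
    then show ?case
      using left_scaling_mult[of A "1 / \<bar>det A\<bar> ^ CARD('n)" B "1 / \<bar>det B\<bar> ^ CARD('n)"]
      by (auto simp: det_mul abs_mult power_mult_distrib)
  next
    case (2 A i)
    then show ?case by (simp add: det_zero_row)
  next
    case (3 A)
    then show ?case using left_scaling_diagonal by blast
  next
    case (4 m n)
    let ?S = "\<chi> i j. mat 1 $ i $ Transposition.transpose m n j :: real^'n^'n"
    have "(?S ** ?S) $ i $ j = mat 1 $ i $ j" for i j
    proof -
      have "(?S ** ?S) $ i $ j = (\<Sum>k\<in>UNIV. if k = Transposition.transpose m n j then mat 1 $ i $ j else 0)"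
        unfolding matrix_matrix_mult_def vec_lambda_beta
        by (intro sum.cong) (auto simp: mat_def)
      then show ?thesis by simp
    qed
    then have SS: "?S ** ?S = mat 1" by (simp add: vec_eq_iff)
    show ?case
    proof
      assume "det ?S \<noteq> 0"
      then obtain c where c: "left_scaling ?S c" using ex_left_scaling by blast
      have "left_scaling (mat 1 :: real^'n^'n) 1" by (simp add: left_scaling_def)
      then have "c * c = 1" using left_scaling_unique[OF left_scaling_mult[OF c c]] SS by simp
      then have "c = 1" using c by (auto simp: left_scaling_def square_eq_1_iff)
      moreover have "det ?S * det ?S = 1" using det_mul[of ?S ?S] SS by simp
      then have "\<bar>det ?S\<bar> = 1" by (auto simp: square_eq_1_iff)
      ultimately show "left_scaling ?S (1 / \<bar>det ?S\<bar> ^ CARD('n))" using c by simp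
    qed
  next
    case (5 m n e)
    let ?E = "\<chi> i j. if i = m \<and> j = n then e else of_bool (i = j) :: real^'n^'n"
    let ?D = "\<chi> i j. if i = j then if i = m then 2 else 1 else 0 :: real^'n^'n"
    have E: "(?E ** M) $ i $ j = M $ i $ j + (if i = m then e * M $ n $ j else 0)" for M :: "real^'n^'n" and i j
    proof -
      have "(?E ** M) $ i $ j = (\<Sum>k\<in>UNIV. (if k = i then M $ i $ j else 0) +
          (if k = n then if i = m then e * M $ n $ j else 0 else 0))"
        unfolding matrix_matrix_mult_def vec_lambda_beta
        using 5 by (intro sum.cong) auto
      then show ?thesis by (simp add: sum.distrib)
    qed
    have D: "(?D ** M) $ i $ j = (if i = m then 2 else 1) * M $ i $ j" for M :: "real^'n^'n" and i j
    proof -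
      have "(?D ** M) $ i $ j = (\<Sum>k\<in>UNIV. if k = i then (if i = m then 2 else 1) * M $ i $ j else 0)"
        unfolding matrix_matrix_mult_def vec_lambda_beta by (intro sum.cong) auto
      then show ?thesis by simp
    qed
    have "(?D ** ?E) $ i $ j = (?E ** (?E ** ?D)) $ i $ j" for i j
      unfolding D E using 5 by auto
    then have eq: "?D ** ?E = ?E ** (?E ** ?D)" by (simp add: vec_eq_iff)
    have "det ?D = (\<Prod>i\<in>UNIV. if i = m then 2 else 1)" by (subst det_diagonal) simp_all
    then have detD: "det ?D \<noteq> 0" by simp
    show ?case
    proof
      assume nz: "det ?E \<noteq> 0"
      then obtain c where c: "left_scaling ?E c" using ex_left_scaling by blast
      obtain d where d: "left_scaling ?D d" using ex_left_scaling detD by blast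
      have "d * c = c * (c * d)"
        using left_scaling_unique[OF left_scaling_mult[OF d c]]
          left_scaling_mult[OF c left_scaling_mult[OF c d]] eq by simp
      then have "c = 1" using c d by (simp add: left_scaling_def)
      moreover have "det ?D * det ?E = det ?E * (det ?E * det ?D)"
        using arg_cong[OF eq, of det] unfolding det_mul .
      then have "det ?E = 1" using nz detD by simp
      ultimately show "left_scaling ?E (1 / \<bar>det ?E\<bar> ^ CARD('n))" using c by simp
    qed
  qed
  with assms show ?thesis by simp
qed

corollary emeasure_lborel_SL_vimage:
  fixes A :: "real^'n^'n" and X :: "(real^'n^'n) set"
  assumes "det A = 1" "X \<in> sets borel"
  shows "emeasure lborel ((\<lambda>M. A ** M) -` X) = emeasure lborel X"
  using left_scaling_det[of A] assms by (simp add: left_scaling_def)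


section \<open>Haar measure\<close>

lemma closed_SL: "closed {A :: real^'n^'n. det A = 1}"
  unfolding det_def by (intro closed_Collect_eq continuous_intros)

lemma sets_borel_carrier_SL:
  "B \<in> sets (borel_carrier (SL_real :: (real^'n^'n) monoid)) \<longleftrightarrow> B \<in> sets borel \<and> B \<subseteq> {A. det A = 1}"
  using borel_closed[OF closed_SL[where 'n='n]] by (auto simp: borel_carrier_def sets_restrict_space_iff)

lemma l_coset_eq_vimage:
  assumes "A ** B = mat 1" "B ** A = mat 1"
  shows "A <#\<^bsub>SL_real\<^esub> X = (\<lambda>M. B ** M) -` X"
proof
  show "A <#\<^bsub>SL_real\<^esub> X \<subseteq> (\<lambda>M. B ** M) -` X"
    using assms(2) by (auto simp: l_coset_SL_real matrix_mul_assoc)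
  show "(\<lambda>M. B ** M) -` X \<subseteq> A <#\<^bsub>SL_real\<^esub> X"
  proof
    fix M assume "M \<in> (\<lambda>M. B ** M) -` X"
    moreover have "M = A ** (B ** M)" by (simp add: matrix_mul_assoc assms(1))
    ultimately show "M \<in> A <#\<^bsub>SL_real\<^esub> X" unfolding l_coset_SL_real by blast
  qed
qed

lemma borel_matrix_mult_vimage:
  fixes B :: "real^'n^'n" and X :: "(real^'n^'n) set"
  assumes "X \<in> sets borel"
  shows "(\<lambda>M. B ** M) -` X \<in> sets borel"
  using measurable_sets[OF borel_measurable_continuous_onI[OF continuous_on_matrix_mult_left] assms]
  by simp

lemma l_coset_in_borel_carrier:
  assumes "det A = 1" "X \<in> sets (borel_carrier SL_real)"
  shows "A <#\<^bsub>SL_real\<^esub> X \<in> sets (borel_carrier SL_real)"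
proof -
  obtain B where B: "A ** B = mat 1" "B ** A = mat 1" using SL_inverse[OF assms(1)] by blast
  have "A <#\<^bsub>SL_real\<^esub> X \<in> sets borel"
    using assms(2) unfolding l_coset_eq_vimage[OF B] sets_borel_carrier_SL
    by (blast intro: borel_matrix_mult_vimage)
  moreover have "A <#\<^bsub>SL_real\<^esub> X \<subseteq> {A. det A = 1}"
    using assms by (auto simp: l_coset_SL_real sets_borel_carrier_SL det_mul)
  ultimately show ?thesis by (simp add: sets_borel_carrier_SL)
qed

definition det_cone :: "(real^'n^'n) set" where
  "det_cone = {M. 0 < det M \<and> det M \<le> 1}"

text \<open>The radial projection of the cone onto the group.\<close>

definition det_normalize :: "real^'n^'n \<Rightarrow> real^'n^'n" where
  "det_normalize M = (det M powr (- 1 / CARD('n))) *\<^sub>R M"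

definition cone_measure :: "(real^'n^'n) measure" where
  "cone_measure = distr (restrict_space lborel det_cone) (borel_carrier SL_real) det_normalize"

lemma det_scaleR: "det (c *\<^sub>R A :: real^'n^'n) = c ^ CARD('n) * det A"
  by (simp add: det_def prod.distrib sum_distrib_left algebra_simps)

lemma det_det_normalize:
  assumes "0 < det M"
  shows "det (det_normalize M) = 1"
proof -
  have "det (det_normalize M) = det M powr (- 1) * det M"
    using assms by (simp add: det_normalize_def det_scaleR powr_power)
  then show ?thesis using assms by (simp add: powr_minus)
qed

lemma det_cone_borel: "det_cone \<in> sets (borel :: (real^'n^'n) measure)"
proof -
  have "continuous_on UNIV (det :: real^'n^'n \<Rightarrow> real)"
    unfolding det_def by (intro continuous_intros)
  then have [measurable]: "(det :: real^'n^'n \<Rightarrow> real) \<in> borel_measurable borel"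
    by (rule borel_measurable_continuous_onI)
  show ?thesis unfolding det_cone_def by measurable
qed

lemma measurable_det_normalize:
  "(det_normalize :: real^'n^'n \<Rightarrow> _) \<in> measurable (restrict_space lborel det_cone) (borel_carrier SL_real)"
  unfolding borel_carrier_def
proof (rule measurable_restrict_space2)
  show "(det_normalize :: real^'n^'n \<Rightarrow> _) \<in> space (restrict_space lborel det_cone) \<rightarrow> carrier SL_real"
    by (auto simp: space_restrict_space det_cone_def det_det_normalize)
  have "continuous_on det_cone (\<lambda>M :: real^'n^'n. det M)"
    unfolding det_def by (intro continuous_intros)
  then have "continuous_on det_cone (det_normalize :: real^'n^'n \<Rightarrow> _)"
    unfolding det_normalize_def
    by (intro continuous_intros) (auto simp: det_cone_def)
  then show "(det_normalize :: real^'n^'n \<Rightarrow> _) \<in> borel_measurable (restrict_space lborel det_cone)"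
    using borel_measurable_continuous_on_restrict
    by (subst measurable_cong_sets[OF sets_restrict_space_cong[OF sets_lborel] refl])
qed

lemma space_cone_measure: "space cone_measure = carrier SL_real"
  by (simp add: cone_measure_def borel_carrier_def space_restrict_space)

lemma sets_cone_measure: "sets cone_measure = sets (borel_carrier SL_real)"
  by (simp add: cone_measure_def)

lemma det_normalize_vimage_borel:
  assumes "B \<in> sets (borel_carrier (SL_real :: (real^'n^'n) monoid))"
  shows "det_normalize -` B \<inter> det_cone \<in> sets borel"
  using measurable_sets[OF measurable_det_normalize assms] det_cone_borel[where 'n='n]
  by (simp add: space_restrict_space sets_restrict_space_iff)

lemma emeasure_cone_measure:
  assumes "B \<in> sets (borel_carrier (SL_real :: (real^'n^'n) monoid))"
  shows "emeasure cone_measure B = emeasure lborel (det_normalize -` B \<inter> det_cone)"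
proof -
  have "emeasure cone_measure B = emeasure (restrict_space lborel det_cone) (det_normalize -` B \<inter> det_cone)"
    unfolding cone_measure_def
    by (subst emeasure_distr[OF measurable_det_normalize assms]) (simp add: space_restrict_space)
  also have "\<dots> = emeasure lborel (det_normalize -` B \<inter> det_cone)"
    using det_cone_borel by (intro emeasure_restrict_space) auto
  finally show ?thesis .
qed

text \<open>A matrix of determinant one acts on the cone over its group by a linear map that preserves
  Lebesgue measure and commutes with the radial projection.\<close>

lemma left_haar_measure_cone_measure:
  "left_haar_measure (SL_real :: (real^'n^'n) monoid) cone_measure"
  unfolding left_haar_measure_def
proof (intro conjI ballI allI impI)
  show "space cone_measure = carrier (SL_real :: (real^'n^'n) monoid)" by (rule space_cone_measure)
  show "sets cone_measure = sets (borel_carrier (SL_real :: (real^'n^'n) monoid))" by (rule sets_cone_measure)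
next
  fix A :: "real^'n^'n" and X :: "(real^'n^'n) set"
  assume A: "A \<in> carrier SL_real" and "X \<in> sets cone_measure"
  then have X: "X \<in> sets (borel_carrier SL_real)" by (simp add: sets_cone_measure)
  from A have detA: "det A = 1" by simp
  obtain B where B: "det B = 1" "A ** B = mat 1" "B ** A = mat 1"
    using SL_inverse[OF detA] .
  have "det_normalize (B ** M) = B ** det_normalize M" for M :: "real^'n^'n"
    by (simp add: det_normalize_def det_mul B(1) linear_cmul[OF linear_matrix_mult_left])
  then have "det_normalize -` (A <#\<^bsub>SL_real\<^esub> X) \<inter> det_cone
      = (\<lambda>M. B ** M) -` (det_normalize -` X \<inter> det_cone)"
    unfolding l_coset_eq_vimage[OF B(2,3)] by (auto simp: det_cone_def det_mul B(1))
  then show "emeasure cone_measure (A <#\<^bsub>SL_real\<^esub> X) = emeasure cone_measure X"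
    using emeasure_lborel_SL_vimage[OF B(1) det_normalize_vimage_borel[OF X]]
    by (simp add: emeasure_cone_measure X l_coset_in_borel_carrier[OF detA X])
next
  fix K :: "(real^'n^'n) set"
  assume "compact K \<and> K \<subseteq> carrier SL_real"
  then have K: "compact K" "K \<in> sets (borel_carrier SL_real)"
    by (auto simp: sets_borel_carrier_SL borel_compact)
  then obtain b where b: "\<And>A. A \<in> K \<Longrightarrow> norm A \<le> b"
    using compact_imp_bounded bounded_iff by metis
  have "norm M \<le> b" if "M \<in> det_normalize -` K \<inter> det_cone" for M
  proof -
    let ?t = "det M powr (1 / CARD('n))"
    have M: "0 < det M" "det M \<le> 1" "det_normalize M \<in> K" using that by (auto simp: det_cone_def)
    then have "?t * det M powr (- 1 / CARD('n)) = 1" by (simp add: powr_add[symmetric])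
    then have eq: "M = ?t *\<^sub>R det_normalize M" by (simp add: det_normalize_def)
    have "?t \<le> 1 powr (1 / CARD('n))" using M by (intro powr_mono2) auto
    then have "?t * norm (det_normalize M) \<le> 1 * norm (det_normalize M)"
      by (intro mult_right_mono) auto
    then have "norm M \<le> norm (det_normalize M)" by (subst eq) simp
    with b[OF M(3)] show ?thesis by simp
  qed
  then have "bounded (det_normalize -` K \<inter> det_cone)" unfolding bounded_iff by blast
  then show "emeasure cone_measure K < \<infinity>"
    using K emeasure_bounded_finite[of "det_normalize -` K \<inter> det_cone"]
    by (simp add: emeasure_cone_measure)
next
  let ?U = "{M :: real^'n^'n. 0 < det M \<and> det M < 1}"
  have "open ?U"
    unfolding det_def by (intro open_Collect_conj open_Collect_less continuous_intros)
  moreover have "(1 / 2) *\<^sub>R mat 1 \<in> ?U"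
    by (simp add: det_scaleR power_one_over)
  ultimately have "emeasure lborel ?U \<noteq> 0" by (intro emeasure_lborel_open_nonzero) auto
  moreover have "emeasure lborel ?U \<le> emeasure lborel (det_cone :: (real^'n^'n) set)"
    using det_cone_borel by (intro emeasure_mono) (auto simp: det_cone_def)
  ultimately have "emeasure lborel (det_cone :: (real^'n^'n) set) \<noteq> 0" by auto
  moreover have "carrier SL_real \<in> sets (borel_carrier (SL_real :: (real^'n^'n) monoid))"
    using borel_closed[OF closed_SL[where 'n='n]] by (simp add: sets_borel_carrier_SL)
  moreover have "det_normalize -` carrier SL_real \<inter> det_cone = (det_cone :: (real^'n^'n) set)"
    by (auto simp: det_cone_def det_det_normalize)
  ultimately show "emeasure cone_measure (carrier (SL_real :: (real^'n^'n) monoid)) \<noteq> 0"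
    by (simp add: emeasure_cone_measure)
qed

section \<open>Fundamental sets\<close>

text \<open>Since \<open>\<gamma> - 1 = (p - 1) - (p' - 1) - (\<gamma> - 1) (p' - 1)\<close>, the largest entry of \<open>\<gamma> - 1\<close> is bounded
  by small terms plus a quarter of itself; an integer matrix so close to the identity equals it.\<close>

lemma SL_int_eq_one_if_near_one:
  fixes p p' \<gamma> :: "real^'n^'n"
  assumes \<gamma>: "\<gamma> \<in> SL_int" and eq: "\<gamma> ** p' = p"
    and p: "\<And>i j. \<bar>p $ i $ j - mat 1 $ i $ j\<bar> < 1 / (4 * CARD('n))"
    and p': "\<And>i j. \<bar>p' $ i $ j - mat 1 $ i $ j\<bar> < 1 / (4 * CARD('n))"
  shows "\<gamma> = mat 1"
proof -
  let ?\<epsilon> = "1 / (4 * real CARD('n))"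
  define E where "E = \<gamma> - mat 1"
  define m where "m = Max (range (\<lambda>(i, j). \<bar>E $ i $ j\<bar>))"
  have m: "\<bar>E $ i $ j\<bar> \<le> m" for i j
    unfolding m_def by (rule Max_ge) (auto intro: image_eqI[where x = "(i, j)"])
  have "m \<in> range (\<lambda>(i, j). \<bar>E $ i $ j\<bar>)"
    unfolding m_def by (rule Max_in) auto
  then obtain i j where ij: "m = \<bar>E $ i $ j\<bar>" by auto
  have "(E ** (p' - mat 1)) = p - \<gamma> - (p' - mat 1)"
  proof -
    have "(\<gamma> - mat 1) ** (p' - mat 1) = \<gamma> ** (p' - mat 1) - mat 1 ** (p' - mat 1)"
      unfolding vec_eq_iff matrix_matrix_mult_def by (simp add: sum_subtractf left_diff_distrib)
    also have "\<gamma> ** (p' - mat 1) = p - \<gamma>"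
      by (simp add: linear_diff[OF linear_matrix_mult_left] eq)
    finally show ?thesis by (simp add: E_def)
  qed
  then have "E $ i $ j = (p $ i $ j - mat 1 $ i $ j) - (p' $ i $ j - mat 1 $ i $ j) - (E ** (p' - mat 1)) $ i $ j"
    by (simp add: E_def)
  moreover have "\<bar>(E ** (p' - mat 1)) $ i $ j\<bar> \<le> (\<Sum>k\<in>(UNIV :: 'n set). m * ?\<epsilon>)"
  proof -
    have "\<bar>(E ** (p' - mat 1)) $ i $ j\<bar> \<le> (\<Sum>k\<in>UNIV. \<bar>E $ i $ k * (p' - mat 1) $ k $ j\<bar>)"
      unfolding matrix_matrix_mult_def vec_lambda_beta by (rule sum_abs)
    also have "\<dots> \<le> (\<Sum>k\<in>(UNIV :: 'n set). m * ?\<epsilon>)"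
      unfolding abs_mult using p' m
      by (intro sum_mono mult_mono) (auto simp: less_imp_le intro: order_trans[OF abs_ge_zero m])
    finally show ?thesis .
  qed
  then have "\<bar>(E ** (p' - mat 1)) $ i $ j\<bar> \<le> m / 4" by simp
  ultimately have "m < 2 * ?\<epsilon> + m / 4" using p[of i j] p'[of i j] ij by linarith
  moreover have "?\<epsilon> \<le> 1 / 4" by (simp add: divide_simps)
  ultimately have "m < 1" by linarith
  then have "\<bar>\<gamma> $ i $ j - mat 1 $ i $ j\<bar> < 1" for i j
    using m[of i j] by (simp add: E_def)
  then show ?thesis using \<gamma> mat_1_SL_int by (rule SL_int_eqI[rotated 2])
qed

text \<open>Countably many relatively open sets cover the group, each of them disjoint from its
  translates by nontrivial elements. Removing from each the orbits of its predecessors leaves one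
  point of every orbit.\<close>

lemma ex_borel_fundamental_set:
  "\<exists>F. borel_fundamental_set SL_real (SL_int :: (real^'n^'n) set) F"
proof -
  let ?\<epsilon> = "1 / (4 * real CARD('n))"
  define N :: "(real^'n^'n) set" where
    "N = {p. \<forall>i j. \<bar>p $ i $ j - mat 1 $ i $ j\<bar> < ?\<epsilon>}"
  have N: "open N"
    unfolding N_def Collect_all_eq
    by (intro open_INT ballI finite open_Collect_less continuous_intros)
  obtain D :: "(real^'n^'n) set" where D: "countable D" "\<And>U. open U \<Longrightarrow> U \<noteq> {} \<Longrightarrow> \<exists>q\<in>D. q \<in> U"
    using countable_dense_setE by blast
  then have "D \<noteq> {}" by (metis UNIV_not_empty empty_iff open_UNIV)
  define q where "q = from_nat_into D"
  \<comment> \<open>If \<open>M\<^sup>-\<^sup>1\<close> is close to \<open>q n\<close>, then \<open>M ** q n\<close> is close to one; as \<open>q\<close> runs through a dense set, these sets cover the group.\<close>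
  define V where "V n = {M. det M = 1 \<and> M ** q n \<in> N}" for n
  have cover: "\<exists>n. M \<in> V n" if M: "det M = 1" for M
  proof -
    obtain h where "M ** h = mat 1" using SL_inverse[OF M] by blast
    then have "h \<in> (\<lambda>q. M ** q) -` N" by (simp add: N_def)
    moreover have "open ((\<lambda>q. M ** q) -` N)"
      by (intro open_vimage N continuous_on_matrix_mult_left)
    ultimately obtain r where "r \<in> D" "M ** r \<in> N" using D(2) by blast
    then show ?thesis using M D(1) unfolding V_def q_def by (metis (mono_tags, lifting) from_nat_into_surj mem_Collect_eq)
  qed
  have V_borel: "V n \<in> sets borel" for n
  proof -
    have "continuous_on UNIV (\<lambda>M :: real^'n^'n. M ** q n)"
      unfolding matrix_matrix_mult_def by (intro continuous_intros)
    then have "open ((\<lambda>M. M ** q n) -` N)" by (rule open_vimage[OF N])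
    moreover have "V n = {M. det M = 1} \<inter> (\<lambda>M. M ** q n) -` N" by (auto simp: V_def)
    ultimately show ?thesis using borel_closed[OF closed_SL[where 'n = 'n]] by auto
  qed
  have trivial: "\<gamma> = mat 1" if "\<gamma> \<in> SL_int" "M \<in> V n" "\<gamma> ** M \<in> V n" for \<gamma> M n
    by (rule SL_int_eq_one_if_near_one[OF that(1), of "M ** q n" "\<gamma> ** M ** q n"])
      (use that in \<open>auto simp: V_def N_def matrix_mul_assoc\<close>)
  define F where "F = (\<Union>n. V n - (\<Union>k\<in>{..<n}. \<Union>\<gamma>\<in>SL_int. (\<lambda>M. \<gamma> ** M) -` V k))"
  have F: "F \<in> sets (borel_carrier SL_real)"
    unfolding sets_borel_carrier_SL
  proof
    show "F \<in> sets borel" unfolding F_def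
      by (intro sets.countable_UN'' sets.Diff sets.countable_UN' V_borel borel_matrix_mult_vimage
          countable_SL_int) auto
    show "F \<subseteq> {A. det A = 1}" by (auto simp: F_def V_def)
  qed
  have "(\<Union>\<gamma>\<in>SL_int. \<gamma> <#\<^bsub>SL_real\<^esub> F) = {M. det M = 1}"
  proof
    show "(\<Union>\<gamma>\<in>SL_int. \<gamma> <#\<^bsub>SL_real\<^esub> F) \<subseteq> {M. det M = 1}"
      by (auto simp: l_coset_SL_real F_def V_def det_mul SL_int_def)
    show "{M. det M = 1} \<subseteq> (\<Union>\<gamma>\<in>SL_int. \<gamma> <#\<^bsub>SL_real\<^esub> F)"
    proof
      fix M :: "real^'n^'n" assume "M \<in> {M. det M = 1}"
      then have "\<exists>n. \<exists>\<gamma>\<in>SL_int. \<gamma> ** M \<in> V n"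
        using cover mat_1_SL_int by (metis matrix_mul_lid mem_Collect_eq)
      then obtain n where n: "\<exists>\<gamma>\<in>SL_int. \<gamma> ** M \<in> V n" and least: "\<And>k. k < n \<Longrightarrow> \<not> (\<exists>\<gamma>\<in>SL_int. \<gamma> ** M \<in> V k)"
        using exists_least_iff[of "\<lambda>n. \<exists>\<gamma>\<in>SL_int. \<gamma> ** M \<in> V n"] by blast
      then obtain \<gamma> where \<gamma>: "\<gamma> \<in> SL_int" "\<gamma> ** M \<in> V n" by blast
      have "\<delta> ** (\<gamma> ** M) \<notin> V k" if "k < n" "\<delta> \<in> SL_int" for k \<delta>
        using least[OF that(1)] SL_int_mult[OF that(2) \<gamma>(1)] by (auto simp: matrix_mul_assoc)
      then have "\<gamma> ** M \<in> F"
        unfolding F_def using \<gamma>(2) by blast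
      moreover obtain \<delta> where "\<delta> \<in> SL_int" "\<delta> ** \<gamma> = mat 1" using SL_int_inverse[OF \<gamma>(1)] by blast
      moreover from this have "M = \<delta> ** (\<gamma> ** M)" by (simp add: matrix_mul_assoc)
      ultimately show "M \<in> (\<Union>\<gamma>\<in>SL_int. \<gamma> <#\<^bsub>SL_real\<^esub> F)"
        unfolding l_coset_SL_real by blast
    qed
  qed
  moreover have "disjoint_family_on (\<lambda>\<gamma>. \<gamma> <#\<^bsub>SL_real\<^esub> F) SL_int"
    unfolding disjoint_family_on_def
  proof (intro ballI impI)
    fix \<gamma> \<delta> :: "real^'n^'n" assume \<gamma>\<delta>: "\<gamma> \<in> SL_int" "\<delta> \<in> SL_int" "\<gamma> \<noteq> \<delta>"
    show "(\<gamma> <#\<^bsub>SL_real\<^esub> F) \<inter> (\<delta> <#\<^bsub>SL_real\<^esub> F) = {}"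
    proof (rule ccontr)
      assume "\<not> ?thesis"
      then obtain A B where AB: "A \<in> F" "B \<in> F" "\<gamma> ** A = \<delta> ** B"
        by (auto simp: l_coset_SL_real)
      obtain \<gamma>' where \<gamma>': "\<gamma>' \<in> SL_int" "\<gamma>' ** \<gamma> = mat 1" "\<gamma> ** \<gamma>' = mat 1"
        using SL_int_inverse[OF \<gamma>\<delta>(1)] by blast
      obtain \<delta>' where \<delta>': "\<delta>' \<in> SL_int" "\<delta>' ** \<delta> = mat 1"
        using SL_int_inverse[OF \<gamma>\<delta>(2)] by blast
      have A: "A = (\<gamma>' ** \<delta>) ** B"
        using arg_cong[OF AB(3), of "\<lambda>M. \<gamma>' ** M"] \<gamma>'(2) by (simp add: matrix_mul_assoc)
      have B: "B = (\<delta>' ** \<gamma>) ** A"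
        using arg_cong[OF AB(3), of "\<lambda>M. \<delta>' ** M"] \<delta>'(2) by (simp add: matrix_mul_assoc)
      have in': "\<gamma>' ** \<delta> \<in> SL_int" "\<delta>' ** \<gamma> \<in> SL_int"
        using \<gamma>\<delta> \<gamma>' \<delta>' by (auto intro: SL_int_mult)
      obtain n where n: "A \<in> V n" "\<And>k \<gamma>. k < n \<Longrightarrow> \<gamma> \<in> SL_int \<Longrightarrow> \<gamma> ** A \<notin> V k"
        using AB(1) by (auto simp: F_def)
      obtain l where l: "B \<in> V l" "\<And>k \<gamma>. k < l \<Longrightarrow> \<gamma> \<in> SL_int \<Longrightarrow> \<gamma> ** B \<notin> V k"
        using AB(2) by (auto simp: F_def)
      have "n = l"
      proof (rule linorder_cases[of n l])
        assume "n < l"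
        then show ?thesis using l(2)[OF _ in'(1)] n(1) A by metis
      next
        assume "l < n"
        then show ?thesis using n(2)[OF _ in'(2)] l(1) B by metis
      qed
      then have "\<gamma>' ** \<delta> = mat 1"
        using trivial[OF in'(1) l(1)] n(1) A by simp
      then have "\<gamma> ** (\<gamma>' ** \<delta>) = \<gamma>" by simp
      then have "\<gamma> = \<delta>" by (simp add: matrix_mul_assoc \<gamma>'(3))
      with \<gamma>\<delta>(3) show False by simp
    qed
  qed
  ultimately show ?thesis using F by (auto simp: borel_fundamental_set_def)
qed

lemma left_haar_measure_SL:
  assumes "left_haar_measure (SL_real :: (real^'n^'n) monoid) m"
  shows "sets m = sets (borel_carrier SL_real)"
    and "\<And>A B. det A = 1 \<Longrightarrow> B \<in> sets m \<Longrightarrow> emeasure m (A <#\<^bsub>SL_real\<^esub> B) = emeasure m B"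
    and "\<And>K. compact K \<Longrightarrow> K \<subseteq> {A. det A = 1} \<Longrightarrow> emeasure m K < \<infinity>"
  using assms by (auto simp: left_haar_measure_def)

text \<open>The fundamental set is covered by its intersections with the translates \<open>\<gamma> S\<close>. Moving these
  back by \<open>\<gamma>\<^sup>-\<^sup>1\<close> makes them disjoint subsets of \<open>S\<close>.\<close>

lemma fundamental_set_le_cover:
  assumes m: "left_haar_measure (SL_real :: (real^'n^'n) monoid) m"
    and F: "borel_fundamental_set SL_real (SL_int :: (real^'n^'n) set) F"
    and S: "S \<in> sets m" and cover: "\<And>M. det M = 1 \<Longrightarrow> \<exists>\<gamma>\<in>SL_int. \<gamma> ** M \<in> S"
  shows "emeasure m F \<le> emeasure m S"
proof -
  note haar = left_haar_measure_SL[OF m]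
  have Fm: "F \<in> sets m" using F haar(1) by (simp add: borel_fundamental_set_def)
  then have F1: "F \<subseteq> {A. det A = 1}" by (simp add: haar(1) sets_borel_carrier_SL)
  define e where "e = from_nat_into (SL_int :: (real^'n^'n) set)"
  define J where "J = to_nat_on (SL_int :: (real^'n^'n) set) ` SL_int"
  have e: "e ` J = SL_int" "inj_on e J"
    using countable_SL_int[where 'n = 'n]
    by (auto simp: e_def J_def image_image inj_on_def)
  have eS: "e n \<in> SL_int" if "n \<in> J" for n using e(1) that by blast
  have det1: "det (e n) = 1" if "n \<in> J" for n using eS[OF that] by (simp add: SL_int_def)
  define X where "X n = (if n \<in> J then (e n <#\<^bsub>SL_real\<^esub> F) \<inter> S else {})" for n
  have trans: "A <#\<^bsub>SL_real\<^esub> B \<in> sets m" if "det A = 1" "B \<in> sets m" for A B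
    using l_coset_in_borel_carrier that by (simp add: haar(1))
  have X: "range X \<subseteq> sets m" using Fm S det1 trans by (auto simp: X_def)
  have disj: "disjoint_family X"
    unfolding disjoint_family_on_def
  proof (intro ballI impI)
    fix a b :: nat assume "a \<noteq> b"
    show "X a \<inter> X b = {}"
    proof (cases "a \<in> J \<and> b \<in> J")
      case True
      with \<open>a \<noteq> b\<close> have "e a \<noteq> e b" using e(2) by (auto dest: inj_onD)
      then have "(e a <#\<^bsub>SL_real\<^esub> F) \<inter> (e b <#\<^bsub>SL_real\<^esub> F) = {}"
        using F eS True by (auto simp: borel_fundamental_set_def disjoint_family_on_def)
      then show ?thesis by (auto simp: X_def)
    qed (auto simp: X_def)
  qed
  define Y where "Y n = (if n \<in> J then {M \<in> F. e n ** M \<in> S} else {})" for n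
  have Y: "Y n \<in> sets m \<and> emeasure m (Y n) = emeasure m (X n)" for n
  proof (cases "n \<in> J")
    case True
    obtain B where B: "det B = 1" "e n ** B = mat 1" "B ** e n = mat 1"
      using SL_inverse[OF det1[OF True]] .
    have "Y n = B <#\<^bsub>SL_real\<^esub> X n"
      unfolding l_coset_eq_vimage[OF B(3,2)] using True B
      by (auto simp: Y_def X_def l_coset_eq_vimage[OF B(2,3)] matrix_mul_assoc)
    moreover have "X n \<in> sets m" using X by blast
    ultimately show ?thesis using haar(2)[OF B(1)] trans[OF B(1)] by simp
  qed (simp add: X_def Y_def)
  have "F \<subseteq> (\<Union>n. Y n)"
  proof
    fix M assume M: "M \<in> F"
    then obtain \<gamma> where "\<gamma> \<in> SL_int" "\<gamma> ** M \<in> S" using F1 cover by blast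
    then obtain n where "n \<in> J" "e n ** M \<in> S" using e(1) by (metis imageE)
    with M show "M \<in> (\<Union>n. Y n)" by (auto simp: Y_def)
  qed
  then have "emeasure m F \<le> emeasure m (\<Union>n. Y n)"
    using Y by (intro emeasure_mono) auto
  also have "\<dots> \<le> (\<Sum>n. emeasure m (Y n))"
    using Y by (intro emeasure_subadditive_countably) auto
  also have "\<dots> = (\<Sum>n. emeasure m (X n))" using Y by simp
  also have "\<dots> = emeasure m (\<Union>n. X n)" by (rule suminf_emeasure[OF X disj])
  also have "\<dots> \<le> emeasure m S" using S by (intro emeasure_mono) (auto simp: X_def)
  finally show ?thesis .
qed

section \<open>Compact blocks of the Siegel set\<close>

text \<open>The triangular factors of one piece of the Siegel set after its diagonal has been normalised;
  \<open>\<delta>\<close> limits the subdiagonal entries. The diagonal is only required to be nonnegative in order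
  to have a closed condition; the determinant makes it positive.\<close>

definition block_triangles :: "('n \<Rightarrow> real) \<Rightarrow> (real^'n^'n) set" where
  "block_triangles \<delta> = {T. lower_triangular T \<and> (\<forall>i. 0 \<le> T $ i $ i) \<and> det T = 1 \<and>
     (\<forall>i j. idx j = Suc (idx i) \<longrightarrow> T $ i $ i \<le> 2 * T $ j $ j) \<and>
     (\<forall>i j. idx j = Suc (idx i) \<longrightarrow> T $ j $ j \<le> T $ i $ i) \<and>
     (\<forall>i j. idx j = Suc (idx i) \<longrightarrow> \<bar>T $ j $ i\<bar> \<le> \<delta> i * (T $ i $ i / 2)) \<and>
     (\<forall>i j. idx j < idx i \<longrightarrow> \<bar>T $ i $ j\<bar> \<le> T $ j $ j / 2)}"

definition siegel_block :: "('n \<Rightarrow> real) \<Rightarrow> (real^'n^'n) set" where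
  "siegel_block \<delta> =
     (\<lambda>(T, Q). T ** Q) ` (block_triangles \<delta> \<times> {Q. orthogonal_matrix Q \<and> det Q = 1})"

lemma block_triangles_diag_pos:
  assumes "T \<in> block_triangles \<delta>"
  shows "0 < T $ i $ i"
proof -
  have "lower_triangular T" "det T = 1" using assms by (auto simp: block_triangles_def)
  then have "(\<Prod>i\<in>UNIV. T $ i $ i) \<noteq> 0" by (simp add: det_lower_triangular[symmetric])
  then have "T $ i $ i \<noteq> 0" by simp
  then show ?thesis using assms by (simp add: block_triangles_def order.strict_iff_order)
qed

lemma block_triangles_subdiag:
  assumes "T \<in> block_triangles \<delta>" "idx j = Suc (idx i)"
  shows "\<bar>T $ j $ i\<bar> \<le> \<delta> i * (T $ i $ i / 2)"
  using assms by (simp only: block_triangles_def mem_Collect_eq)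

lemma block_triangles_diag_ratio:
  assumes T: "T \<in> block_triangles \<delta>" and "idx b = idx a + n"
  shows "T $ b $ b \<le> T $ a $ a \<and> T $ a $ a \<le> 2 ^ n * T $ b $ b"
  using assms(2)
proof (induction n arbitrary: b)
  case 0
  then show ?case by (metis add_0_right idx_eq_iff mult_1 order_refl power_0)
next
  case (Suc n)
  obtain c :: 'a where c: "idx c = idx a + n"
    using ex_idx[of "idx a + n", where 'n = 'a] idx_less_card[of b] Suc.prems by auto
  have "T $ c $ c \<le> 2 * T $ b $ b" "T $ b $ b \<le> T $ c $ c"
    using T Suc.prems c by (auto simp: block_triangles_def)
  moreover from this have "2 ^ n * T $ c $ c \<le> 2 ^ Suc n * T $ b $ b" by simp
  ultimately show ?case using Suc.IH[OF c] by linarith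
qed

text \<open>Consecutive diagonal entries are comparable and the product of all of them is one, so none of
  them is large.\<close>

lemma block_triangles_diag_le:
  fixes T :: "real^'n^'n"
  assumes T: "T \<in> block_triangles \<delta>"
  shows "T $ i $ i \<le> 2 ^ CARD('n)"
proof (rule ccontr)
  assume large: "\<not> ?thesis"
  have "1 < T $ j $ j" for j
  proof -
    have pow: "(2 :: real) ^ (idx j - idx i) \<le> 2 ^ CARD('n)"
      using idx_less_card[of j] by (intro power_increasing) auto
    have "T $ i $ i \<le> 2 ^ CARD('n) * T $ j $ j"
    proof (cases "idx i \<le> idx j")
      case True
      then have "T $ i $ i \<le> 2 ^ (idx j - idx i) * T $ j $ j"
        using block_triangles_diag_ratio[OF T, of j i "idx j - idx i"] by simp
      also have "\<dots> \<le> 2 ^ CARD('n) * T $ j $ j"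
        using pow block_triangles_diag_pos[OF T, of j] by (intro mult_right_mono) auto
      finally show ?thesis .
    next
      case False
      then have "1 * T $ i $ i \<le> 1 * T $ j $ j"
        using block_triangles_diag_ratio[OF T, of i j "idx i - idx j"] by simp
      also have "\<dots> \<le> 2 ^ CARD('n) * T $ j $ j"
        using block_triangles_diag_pos[OF T, of j] by (intro mult_right_mono) auto
      finally show ?thesis by simp
    qed
    moreover have "2 ^ CARD('n) * T $ j $ j \<le> 2 ^ CARD('n) * 1" if "\<not> 1 < T $ j $ j"
      using that by (intro mult_left_mono) auto
    ultimately show ?thesis using large by linarith
  qed
  then have "1 < (\<Prod>j\<in>UNIV. T $ j $ j)" by (intro less_1_prod) auto
  moreover have "(\<Prod>j\<in>UNIV. T $ j $ j) = 1"
    using T by (simp add: block_triangles_def det_lower_triangular[symmetric])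
  ultimately show False by simp
qed

lemma block_triangles_entry_le:
  fixes T :: "real^'n^'n"
  assumes T: "T \<in> block_triangles \<delta>"
  shows "\<bar>T $ i $ j\<bar> \<le> 2 ^ CARD('n)"
proof -
  note d = block_triangles_diag_le[OF T] block_triangles_diag_pos[OF T]
  consider "i = j" | "idx i < idx j" | "idx j < idx i" by (metis linorder_neqE_nat idx_eq_iff)
  then show ?thesis
  proof cases
    case 1
    then show ?thesis using d[of j] by simp
  next
    case 2
    then show ?thesis using T by (simp add: block_triangles_def lower_triangular_def)
  next
    case 3
    then have "\<bar>T $ i $ j\<bar> \<le> T $ j $ j / 2" using T by (simp add: block_triangles_def)
    then show ?thesis using d[of j] by simp
  qed
qed

lemma siegel_block_entry_le:
  fixes g :: "real^'n^'n"
  assumes "g \<in> siegel_block \<delta>"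
  shows "\<bar>g $ i $ j\<bar> \<le> real CARD('n) * (2 ^ CARD('n) * 1)"
proof -
  obtain T Q where TQ: "g = T ** Q" "T \<in> block_triangles \<delta>" "orthogonal_matrix Q"
    using assms by (auto simp: siegel_block_def)
  show ?thesis unfolding TQ(1)
    using block_triangles_entry_le[OF TQ(2)] orthogonal_matrix_entry_bound[OF TQ(3)]
    by (rule matrix_mult_entry_bound)
qed

lemma bounded_matrices: "bounded {M :: real^'n^'m. \<forall>i j. \<bar>M $ i $ j\<bar> \<le> R}"
proof -
  have "norm M \<le> (\<Sum>i\<in>(UNIV :: 'm set). \<Sum>j\<in>(UNIV :: 'n set). R)"
    if "\<forall>i j. \<bar>M $ i $ j\<bar> \<le> R" for M :: "real^'n^'m"
  proof -
    have "norm M \<le> (\<Sum>i\<in>UNIV. norm (M $ i))"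
      unfolding norm_vec_def by (rule L2_set_le_sum) simp
    also have "\<dots> \<le> (\<Sum>i\<in>(UNIV :: 'm set). \<Sum>j\<in>(UNIV :: 'n set). R)"
      using that by (intro sum_mono order_trans[OF norm_le_l1_cart]) auto
    finally show ?thesis .
  qed
  then show ?thesis unfolding bounded_iff by blast
qed

lemma compact_block_triangles: "compact (block_triangles \<delta> :: (real^'n^'n) set)"
proof -
  have "bounded (block_triangles \<delta> :: (real^'n^'n) set)"
    by (rule bounded_subset[OF bounded_matrices[of "2 ^ CARD('n)"]])
      (auto intro: block_triangles_entry_le)
  moreover have "closed (block_triangles \<delta> :: (real^'n^'n) set)"
    unfolding block_triangles_def lower_triangular_def det_def
    by (intro closed_Collect_conj closed_Collect_all closed_Collect_imp open_Collect_const
        closed_Collect_le closed_Collect_eq continuous_intros) simp_all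
  ultimately show ?thesis by (simp add: compact_eq_bounded_closed)
qed

lemma compact_special_orthogonal:
  "compact {Q :: real^'n^'n. orthogonal_matrix Q \<and> det Q = 1}"
proof -
  have "bounded {Q :: real^'n^'n. orthogonal_matrix Q \<and> det Q = 1}"
    by (rule bounded_subset[OF bounded_matrices[of 1]]) (auto intro: orthogonal_matrix_entry_bound)
  moreover have "closed {Q :: real^'n^'n. orthogonal_matrix Q \<and> det Q = 1}"
    unfolding orthogonal_matrix matrix_matrix_mult_def Finite_Cartesian_Product.transpose_def det_def
    by (intro closed_Collect_conj closed_Collect_eq continuous_intros)
  ultimately show ?thesis by (simp add: compact_eq_bounded_closed)
qed

text \<open>Compactness is what makes the blocks Borel sets.\<close>

lemma compact_siegel_block: "compact (siegel_block \<delta> :: (real^'n^'n) set)"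
  unfolding siegel_block_def
proof (intro compact_continuous_image compact_Times compact_block_triangles compact_special_orthogonal)
  show "continuous_on (block_triangles \<delta> \<times> {Q :: real^'n^'n. orthogonal_matrix Q \<and> det Q = 1})
    (\<lambda>(T, Q). T ** Q)"
    unfolding matrix_matrix_mult_def case_prod_beta by (intro continuous_intros)
qed

lemma siegel_block_SL: "siegel_block \<delta> \<subseteq> {A. det A = 1}"
  by (auto simp: siegel_block_def block_triangles_def det_mul)

lemma siegel_block_borel: "siegel_block \<delta> \<in> sets (borel_carrier SL_real)"
  by (simp add: sets_borel_carrier_SL siegel_block_SL borel_compact compact_siegel_block)

section \<open>Packing\<close>

text \<open>The parameter \<open>l\<close> picks a grid point with spacing \<open>2 / 2 ^ k\<close> in the subdiagonal.\<close>

definition shear :: "('n \<Rightarrow> nat) \<Rightarrow> ('n \<Rightarrow> nat) \<Rightarrow> real^'n^'n" where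
  "shear k l = (\<chi> a b. if a = b then 1 else if idx a = Suc (idx b) then 2 * l b / 2 ^ k b else 0)"

lemma shear_triangular:
  "lower_triangular (shear k l)" "shear k l $ i $ i = 1" "det (shear k l) = 1"
proof -
  show "lower_triangular (shear k l)" by (auto simp: lower_triangular_def shear_def)
  then show "det (shear k l) = 1" by (simp add: det_lower_triangular shear_def)
qed (simp add: shear_def)

lemma shear_mult_subdiag:
  assumes T: "lower_triangular T" and ij: "idx j = Suc (idx i)"
  shows "(shear k l ** T) $ j $ i = T $ j $ i + 2 * l i / 2 ^ k i * T $ i $ i"
proof -
  have ne: "i \<noteq> j" using ij by auto
  have "shear k l $ j $ a * T $ a $ i = (if a = j then T $ j $ i else 0) +
      (if a = i then 2 * l i / 2 ^ k i * T $ i $ i else 0)" for a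
  proof -
    consider "a = j" | "a = i" | "a \<noteq> j" "idx j \<noteq> Suc (idx a)"
      using ij by (metis idx_eq_iff nat.inject)
    then show ?thesis
      using ne ij by cases (auto simp: shear_def)
  qed
  then show ?thesis
    unfolding matrix_matrix_mult_def by (simp add: sum.distrib)
qed

text \<open>Translation by a shear moves the subdiagonal entries, relative to the diagonal, by multiples
  of \<open>2 / 2 ^ k\<close>, while within the block they vary by at most \<open>1 / 2 ^ k\<close>.\<close>

lemma shear_translates_disjoint:
  fixes k :: "'n::finite \<Rightarrow> nat"
  assumes last: "\<And>i. Suc (idx i) = CARD('n) \<Longrightarrow> k i = 0"
  shows "disjoint_family_on (\<lambda>l. shear k l <#\<^bsub>SL_real\<^esub> siegel_block (\<lambda>i. 1 / 2 ^ k i))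
    (\<Pi>\<^sub>E i\<in>UNIV. {..<2 ^ k i})"
  unfolding disjoint_family_on_def
proof (intro ballI impI)
  fix l l' :: "'n \<Rightarrow> nat"
  assume l: "l \<in> (\<Pi>\<^sub>E i\<in>UNIV. {..<2 ^ k i})" and l': "l' \<in> (\<Pi>\<^sub>E i\<in>UNIV. {..<2 ^ k i})" and "l \<noteq> l'"
  let ?B = "siegel_block (\<lambda>i. 1 / 2 ^ k i)"
  show "(shear k l <#\<^bsub>SL_real\<^esub> ?B) \<inter> (shear k l' <#\<^bsub>SL_real\<^esub> ?B) = {}"
  proof (rule ccontr)
    assume "\<not> ?thesis"
    then obtain A A' where AA: "A \<in> ?B" "A' \<in> ?B" "shear k l ** A = shear k l' ** A'"
      by (auto simp: l_coset_SL_real)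
    then obtain T Q T' Q' where T: "A = T ** Q" "T \<in> block_triangles (\<lambda>i. 1 / 2 ^ k i)" "orthogonal_matrix Q"
      and T': "A' = T' ** Q'" "T' \<in> block_triangles (\<lambda>i. 1 / 2 ^ k i)" "orthogonal_matrix Q'"
      by (auto simp: siegel_block_def)
    have low: "lower_triangular T" "lower_triangular T'"
      using T T' by (auto simp: block_triangles_def)
    have diag: "(shear k m ** S) $ i $ i = S $ i $ i" if "lower_triangular S" for m S i
      using that by (simp add: lower_triangular_mult_diag shear_triangular)
    have "iwasawa (shear k l ** A) (shear k l ** T) Q"
      using T low block_triangles_diag_pos[OF T(2)] shear_triangular(1)
      by (auto simp: iwasawa_def matrix_mul_assoc diag intro: lower_triangular_mult)
    moreover have "iwasawa (shear k l ** A) (shear k l' ** T') Q'"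
      unfolding AA(3)
      using T' low block_triangles_diag_pos[OF T'(2)] shear_triangular(1)
      by (auto simp: iwasawa_def matrix_mul_assoc diag intro: lower_triangular_mult)
    ultimately have eq: "shear k l ** T = shear k l' ** T'" by (rule iwasawa_unique)
    have "l i = l' i" for i
    proof (cases "Suc (idx i) = CARD('n)")
      case True
      then have "k i = 0" by (rule last)
      then show ?thesis using PiE_mem[OF l, of i] PiE_mem[OF l', of i] by simp
    next
      case False
      then have "Suc (idx i) < CARD('n)" using idx_less_card[of i] by linarith
      then obtain j :: 'n where j: "idx j = Suc (idx i)" using ex_idx by blast
      define t where "t = T $ i $ i"
      have t: "0 < t" "T' $ i $ i = t"
        using block_triangles_diag_pos[OF T(2), of i] diag[OF low(1), of l i] diag[OF low(2), of l' i]
        by (simp_all add: t_def eq)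
      have sub: "T $ j $ i + 2 * l i / 2 ^ k i * t = T' $ j $ i + 2 * l' i / 2 ^ k i * t"
        using arg_cong[OF eq, of "\<lambda>M. M $ j $ i"]
        by (simp add: shear_mult_subdiag low j t t_def[symmetric])
      have "\<bar>T $ j $ i\<bar> \<le> 1 / 2 ^ k i * (t / 2)" "\<bar>T' $ j $ i\<bar> \<le> 1 / 2 ^ k i * (t / 2)"
        using block_triangles_subdiag[OF T(2) j] block_triangles_subdiag[OF T'(2) j]
        by (simp_all only: t(2) t_def[symmetric])
      have "\<bar>2 * l i / 2 ^ k i * t - 2 * l' i / 2 ^ k i * t\<bar> \<le> 1 / 2 ^ k i * t"
      proof -
        have "1 / 2 ^ k i * (t / 2) = 1 / 2 ^ k i * t / 2" by simp
        with \<open>\<bar>T $ j $ i\<bar> \<le> _\<close> \<open>\<bar>T' $ j $ i\<bar> \<le> _\<close> sub show ?thesis unfolding abs_le_iff by linarith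
      qed
      moreover have "2 * l i / 2 ^ k i * t - 2 * l' i / 2 ^ k i * t
          = (real (l i) - real (l' i)) * (2 * (t / 2 ^ k i))"
        by (simp add: algebra_simps diff_divide_distrib)
      ultimately have "\<bar>real (l i) - real (l' i)\<bar> * (2 * (t / 2 ^ k i)) \<le> 1 / 2 * (2 * (t / 2 ^ k i))"
        using t by (simp add: abs_mult)
      moreover have "0 < 2 * (t / 2 ^ k i)" using t by simp
      ultimately have "\<bar>real (l i) - real (l' i)\<bar> \<le> 1 / 2" by (rule mult_right_le_imp_le)
      then show ?thesis by linarith
    qed
    with \<open>l \<noteq> l'\<close> show False by auto
  qed
qed

text \<open>A compact set that contains all the shear translates of all the blocks: the constant comes from
  bounding the entries of a shear by two, those of a triangular factor by
  \<open>2 ^ d\<close> and those of an orthogonal factor by one, for matrices of size \<open>d\<close>.\<close>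

definition packing_region :: "(real^'n^'n) set" where
  "packing_region = {A. det A = 1 \<and>
     (\<forall>i j. \<bar>A $ i $ j\<bar> \<le> real CARD('n) * (2 * (real CARD('n) * (2 ^ CARD('n) * 1))))}"

lemma compact_packing_region: "compact (packing_region :: (real^'n^'n) set)"
proof -
  have "bounded (packing_region :: (real^'n^'n) set)"
    by (rule bounded_subset[OF bounded_matrices[of "real CARD('n) * (2 * (real CARD('n) * (2 ^ CARD('n) * 1)))"]])
      (auto simp: packing_region_def)
  moreover have "closed (packing_region :: (real^'n^'n) set)"
    unfolding packing_region_def det_def
    by (intro closed_Collect_conj closed_Collect_all closed_Collect_le closed_Collect_eq continuous_intros)
  ultimately show ?thesis by (simp add: compact_eq_bounded_closed)
qed

lemma shear_translate_in_packing_region: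
  fixes k :: "'n::finite \<Rightarrow> nat"
  assumes l: "l \<in> (\<Pi>\<^sub>E i\<in>UNIV. {..<2 ^ k i})"
  shows "shear k l <#\<^bsub>SL_real\<^esub> siegel_block \<delta> \<subseteq> packing_region"
proof
  fix M assume "M \<in> shear k l <#\<^bsub>SL_real\<^esub> siegel_block \<delta>"
  then obtain A where A: "A \<in> siegel_block \<delta>" "M = shear k l ** A" by (auto simp: l_coset_SL_real)
  have "\<bar>shear k l $ i $ j\<bar> \<le> 2" for i j
  proof -
    have "real (l j) \<le> 2 ^ k j"
      using PiE_mem[OF l, of j] by (metis UNIV_I lessThan_iff less_imp_le of_nat_le_iff of_nat_numeral of_nat_power)
    then show ?thesis by (auto simp: shear_def divide_le_eq)
  qed
  then have "\<bar>M $ i $ j\<bar> \<le> real CARD('n) * (2 * (real CARD('n) * (2 ^ CARD('n) * 1)))" for i j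
    unfolding A(2) using siegel_block_entry_le[OF A(1)] by (rule matrix_mult_entry_bound)
  moreover have "det M = 1" using A siegel_block_SL by (auto simp: det_mul shear_triangular)
  ultimately show "M \<in> packing_region" by (simp add: packing_region_def)
qed

text \<open>The disjoint translates by the \<open>\<Prod>\<^sub>i 2 ^ k\<^sub>i\<close> grid points all have the measure of the block
  and lie in the packing region.\<close>

lemma siegel_block_packing:
  fixes k :: "'n::finite \<Rightarrow> nat"
  assumes m: "left_haar_measure (SL_real :: (real^'n^'n) monoid) m"
    and last: "\<And>i. Suc (idx i) = CARD('n) \<Longrightarrow> k i = 0"
  shows "(\<Prod>i\<in>UNIV. 2 ^ k i) * emeasure m (siegel_block (\<lambda>i. 1 / 2 ^ k i)) \<le> emeasure m packing_region"
proof -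
  note haar = left_haar_measure_SL[OF m]
  let ?I = "\<Pi>\<^sub>E i\<in>(UNIV :: 'n set). {..<2 ^ k i :: nat}"
  let ?B = "siegel_block (\<lambda>i. 1 / 2 ^ k i) :: (real^'n^'n) set"
  have B: "?B \<in> sets m" by (simp add: haar(1) siegel_block_borel)
  have region: "packing_region \<in> sets m"
    unfolding haar(1) sets_borel_carrier_SL
    by (auto simp: borel_compact compact_packing_region) (auto simp: packing_region_def)
  have fin: "finite ?I" by (intro finite_PiE) auto
  have "(\<Prod>i\<in>UNIV. 2 ^ k i) * emeasure m ?B = of_nat (card ?I) * emeasure m ?B"
    by (simp add: card_PiE)
  also have "\<dots> = (\<Sum>l\<in>?I. emeasure m (shear k l <#\<^bsub>SL_real\<^esub> ?B))"
    by (simp add: haar(2)[OF shear_triangular(3) B])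
  also have "\<dots> = emeasure m (\<Union>l\<in>?I. shear k l <#\<^bsub>SL_real\<^esub> ?B)"
    using shear_translates_disjoint[OF last] l_coset_in_borel_carrier[OF shear_triangular(3)] B fin
    by (intro sum_emeasure) (auto simp: haar(1))
  also have "\<dots> \<le> emeasure m packing_region"
    using shear_translate_in_packing_region region by (intro emeasure_mono UN_least) blast+
  finally show ?thesis .
qed

section \<open>The Siegel set has finite measure\<close>

definition diag_mat :: "('n \<Rightarrow> real) \<Rightarrow> real^'n^'n" where
  "diag_mat a = (\<chi> i j. if i = j then a i else 0)"

lemma diag_mat_mult: "(diag_mat a ** M) $ i $ j = a i * M $ i $ j"
proof -
  have "(diag_mat a ** M) $ i $ j = (\<Sum>k\<in>UNIV. if k = i then a i * M $ i $ j else 0)"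
    unfolding matrix_matrix_mult_def vec_lambda_beta by (intro sum.cong) (auto simp: diag_mat_def)
  then show ?thesis by simp
qed

lemma det_diag_mat: "det (diag_mat a) = (\<Prod>i\<in>UNIV. a i)"
  by (subst det_diagonal) (simp_all add: diag_mat_def)

text \<open>The ratios determine the entries up to a common factor, which is fixed by the determinant.\<close>

lemma ex_diagonal_with_ratios:
  fixes k :: "'n::finite \<Rightarrow> nat"
  shows "\<exists>a. (\<forall>i. 0 < a i) \<and> (\<Prod>i\<in>UNIV. a i) = (1 :: real) \<and>
    (\<forall>i j. idx j = Suc (idx i) \<longrightarrow> a j = 2 ^ k i * a i) \<and> (\<forall>i j. idx j \<le> idx i \<longrightarrow> a j \<le> a i)"
proof -
  define w where "w i = (\<Prod>j | idx j < idx i. (2 :: real) ^ k j)" for i :: 'n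
  define c where "c = root CARD('n) (1 / (\<Prod>i\<in>UNIV. w i))"
  have w: "0 < w i" for i unfolding w_def by (intro prod_pos) auto
  then have W: "0 < (\<Prod>i\<in>UNIV. w i)" by (intro prod_pos) auto
  then have c: "0 < c" by (simp add: c_def)
  have "c ^ CARD('n) = 1 / (\<Prod>i\<in>UNIV. w i)"
    unfolding c_def using W by (intro real_root_pow_pos2) auto
  moreover have "w i \<noteq> 0" for i using w[of i] by simp
  ultimately have "(\<Prod>i\<in>UNIV. c * w i) = 1" by (simp add: prod.distrib)
  moreover have "w j = 2 ^ k i * w i" if "idx j = Suc (idx i)" for i j
  proof -
    have "{x. idx x < idx j} = insert i {x. idx x < idx i}" using that by (auto simp: less_Suc_eq)
    then show ?thesis by (simp add: w_def)
  qed
  moreover have "w j \<le> w i" if "idx j \<le> idx i" for i j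
    unfolding w_def using that by (intro prod_mono2) auto
  ultimately show ?thesis
    using c w by (intro exI[where x = "\<lambda>i. c * w i"]) auto
qed

definition ratio_diagonal :: "('n::finite \<Rightarrow> nat) \<Rightarrow> 'n \<Rightarrow> real" where
  "ratio_diagonal k = (SOME a. (\<forall>i. 0 < a i) \<and> (\<Prod>i\<in>UNIV. a i) = 1 \<and>
    (\<forall>i j. idx j = Suc (idx i) \<longrightarrow> a j = 2 ^ k i * a i) \<and> (\<forall>i j. idx j \<le> idx i \<longrightarrow> a j \<le> a i))"

lemma ratio_diagonal:
  fixes k :: "'n::finite \<Rightarrow> nat"
  shows "0 < ratio_diagonal k i" "det (diag_mat (ratio_diagonal k)) = 1"
    "idx j = Suc (idx i) \<Longrightarrow> ratio_diagonal k j = 2 ^ k i * ratio_diagonal k i"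
    "idx j \<le> idx i \<Longrightarrow> ratio_diagonal k j \<le> ratio_diagonal k i"
  using someI_ex[OF ex_diagonal_with_ratios[of k]]
  unfolding ratio_diagonal_def[symmetric] det_diag_mat by blast+

text \<open>The last index has no successor, so no ratio belongs to it; its exponent is set to zero in order
  to parametrise every piece once and to contribute the factor one to the products.\<close>

definition siegel_index :: "('n::finite \<Rightarrow> nat) set" where
  "siegel_index = {k. \<forall>i. Suc (idx i) = CARD('n) \<longrightarrow> k i = 0}"

definition siegel_piece :: "('n::finite \<Rightarrow> nat) \<Rightarrow> (real^'n^'n) set" where
  "siegel_piece k = diag_mat (ratio_diagonal k) <#\<^bsub>SL_real\<^esub> siegel_block (\<lambda>i. 1 / 2 ^ k i)"

lemma siegel_piece_borel: "siegel_piece k \<in> sets (borel_carrier SL_real)"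
  unfolding siegel_piece_def
  by (intro l_coset_in_borel_carrier siegel_block_borel ratio_diagonal)

lemma ex_dyadic_approximation:
  fixes x y :: real
  assumes "0 < x" "x \<le> 2 * y"
  shows "\<exists>n. y \<le> 2 ^ n * x \<and> 2 ^ n * x \<le> 2 * y"
proof -
  obtain n0 where "y / x < 2 ^ n0" using real_arch_pow[of 2 "y / x"] by auto
  then have "\<exists>n. y \<le> 2 ^ n * x" using assms(1) by (auto simp: field_simps intro!: exI[of _ n0])
  then obtain n where n: "y \<le> 2 ^ n * x" "\<And>k. k < n \<Longrightarrow> \<not> y \<le> 2 ^ k * x"
    using exists_least_iff[of "\<lambda>n. y \<le> 2 ^ n * x"] by blast
  have "2 ^ n * x \<le> 2 * y"
  proof (cases n)
    case 0
    then show ?thesis using assms by simp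
  next
    case (Suc j)
    then show ?thesis using n(2)[of j] by simp
  qed
  with n show ?thesis by blast
qed

text \<open>Dividing row \<open>i\<close> of a reduced triangular factor by \<open>a\<^sub>i\<close> levels the diagonal. Since the ratio
  of \<open>a\<^sub>j\<close> to \<open>a\<^sub>i\<close> is \<open>2 ^ k\<^sub>i\<close> for the successor \<open>j\<close> of \<open>i\<close>, the subdiagonal entry shrinks by
  that factor relative to the diagonal.\<close>

lemma siegel_pieces_cover:
  fixes g :: "real^'n^'n"
  assumes g: "det g = 1"
  shows "\<exists>\<gamma>\<in>SL_int. \<gamma> ** g \<in> (\<Union>k\<in>siegel_index. siegel_piece k)"
proof -
  obtain \<gamma> T Q where \<gamma>: "\<gamma> \<in> SL_int" and iw: "iwasawa (\<gamma> ** g) T Q" and size: "size_reduced T"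
    and ratio: "\<And>i j. idx j = Suc (idx i) \<Longrightarrow> T $ i $ i \<le> 2 * T $ j $ j"
    using ex_reduced_representative[OF g] by blast
  have T: "\<gamma> ** g = T ** Q" "lower_triangular T" "\<And>i. 0 < T $ i $ i" "orthogonal_matrix Q"
    using iw by (auto simp: iwasawa_def)
  have "\<exists>n. (Suc (idx i) = CARD('n) \<longrightarrow> n = 0) \<and>
      (\<forall>j. idx j = Suc (idx i) \<longrightarrow> T $ j $ j \<le> 2 ^ n * T $ i $ i \<and> 2 ^ n * T $ i $ i \<le> 2 * T $ j $ j)" for i
  proof (cases "Suc (idx i) = CARD('n)")
    case True
    then have "idx j \<noteq> Suc (idx i)" for j :: 'n using idx_less_card[of j] by simp
    then show ?thesis by auto
  next
    case False
    then have "Suc (idx i) < CARD('n)" using idx_less_card[of i] by linarith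
    then obtain j :: 'n where j: "idx j = Suc (idx i)" using ex_idx by blast
    then have "j' = j" if "idx j' = Suc (idx i)" for j' using that by (metis idx_eq_iff)
    with False ex_dyadic_approximation[OF T(3) ratio[OF j]] show ?thesis by metis
  qed
  then have "\<forall>i. \<exists>n. (Suc (idx i) = CARD('n) \<longrightarrow> n = 0) \<and>
      (\<forall>j. idx j = Suc (idx i) \<longrightarrow> T $ j $ j \<le> 2 ^ n * T $ i $ i \<and> 2 ^ n * T $ i $ i \<le> 2 * T $ j $ j)"
    by blast
  from choice[OF this] obtain k where
    "\<forall>i. (Suc (idx i) = CARD('n) \<longrightarrow> k i = 0) \<and>
      (\<forall>j. idx j = Suc (idx i) \<longrightarrow> T $ j $ j \<le> 2 ^ k i * T $ i $ i \<and> 2 ^ k i * T $ i $ i \<le> 2 * T $ j $ j)"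
    by blast
  then have last: "\<And>i. Suc (idx i) = CARD('n) \<Longrightarrow> k i = 0"
    and k: "\<And>i j. idx j = Suc (idx i) \<Longrightarrow> T $ j $ j \<le> 2 ^ k i * T $ i $ i"
      "\<And>i j. idx j = Suc (idx i) \<Longrightarrow> 2 ^ k i * T $ i $ i \<le> 2 * T $ j $ j"
    by simp_all
  define a where "a = ratio_diagonal k"
  note a = ratio_diagonal[where k = k, folded a_def]
  define S where "S = diag_mat (\<lambda>i. 1 / a i) ** T"
  have S: "S $ i $ j = T $ i $ j / a i" for i j by (simp add: S_def diag_mat_mult)
  have a_nz: "a i \<noteq> 0" for i using a(1)[of i] by simp
  have eq: "T = diag_mat a ** S"
    by (simp add: vec_eq_iff diag_mat_mult S a_nz)
  have det: "det T = 1 \<and> det Q = 1"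
  proof -
    have "0 < det T" using T(2,3) by (simp add: det_lower_triangular prod_pos)
    moreover have "det T * det Q = 1"
    proof -
      have "det (T ** Q) = 1" using g \<gamma> by (simp add: T(1)[symmetric] det_mul SL_int_def)
      then show ?thesis by (simp add: det_mul)
    qed
    ultimately show ?thesis using det_orthogonal_matrix[OF T(4)] by auto
  qed
  have "S \<in> block_triangles (\<lambda>i. 1 / 2 ^ k i)"
    unfolding block_triangles_def
  proof (intro CollectI conjI allI impI)
    show "lower_triangular S" using T(2) by (simp add: lower_triangular_def S)
    show "0 \<le> S $ i $ i" for i using T(3)[of i] a(1)[of i] by (simp add: S)
    have "det T = det (diag_mat a) * det S" unfolding eq by (rule det_mul)
    then show "det S = 1" using det a(2) by simp
  next
    fix i j :: 'n assume ij: "idx j = Suc (idx i)"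
    note ai = a(1)[of i]
    show "S $ i $ i \<le> 2 * S $ j $ j"
      using k(2)[OF ij] ai by (simp add: S a(3)[OF ij] field_simps)
    show "S $ j $ j \<le> S $ i $ i"
      using k(1)[OF ij] ai by (simp add: S a(3)[OF ij] field_simps)
    have "\<bar>T $ j $ i\<bar> \<le> T $ i $ i / 2" using size ij by (simp add: size_reduced_def)
    then show "\<bar>S $ j $ i\<bar> \<le> 1 / 2 ^ k i * (S $ i $ i / 2)"
      using ai by (simp add: S a(3)[OF ij] abs_divide abs_mult field_simps)
  next
    fix i j :: 'n assume ij: "idx j < idx i"
    have "\<bar>T $ i $ j\<bar> / a i \<le> (T $ j $ j / 2) / a i"
      using size ij a(1)[of i] by (intro divide_right_mono) (auto simp: size_reduced_def less_imp_le)
    also have "\<dots> \<le> (T $ j $ j / 2) / a j"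
      using a(4)[of j i] ij a(1)[of i] a(1)[of j] T(3)[of j] by (intro divide_left_mono) auto
    finally show "\<bar>S $ i $ j\<bar> \<le> S $ j $ j / 2"
      using a(1)[of i] by (simp add: S)
  qed
  then have "S ** Q \<in> siegel_block (\<lambda>i. 1 / 2 ^ k i)"
    unfolding siegel_block_def using T(4) det by (intro image_eqI[where x = "(S, Q)"]) auto
  moreover have "\<gamma> ** g = diag_mat a ** (S ** Q)" using T(1) eq by (simp add: matrix_mul_assoc)
  ultimately have "\<gamma> ** g \<in> siegel_piece k"
    unfolding siegel_piece_def a_def l_coset_SL_real by blast
  moreover have "k \<in> siegel_index" using last by (simp add: siegel_index_def)
  ultimately show ?thesis using \<gamma> by blast
qed

text \<open>The sum of \<open>\<Prod>\<^sub>i 2 ^ (- k\<^sub>i)\<close> over all tuples with entries up to \<open>N\<close> is the \<open>d\<close>-th power of a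
  partial geometric sum, so it is at most \<open>2 ^ d\<close>.\<close>

lemma emeasure_siegel_set_finite:
  assumes m: "left_haar_measure (SL_real :: (real^'n^'n) monoid) m"
  shows "emeasure m (\<Union>k\<in>siegel_index. siegel_piece k) < \<infinity>"
proof -
  note haar = left_haar_measure_SL[OF m]
  have "emeasure m packing_region < \<infinity>"
    by (rule haar(3)[OF compact_packing_region]) (auto simp: packing_region_def)
  then obtain r where r: "emeasure m packing_region = ennreal r" "0 \<le> r"
    by (cases "emeasure m packing_region") auto
  have piece: "emeasure m (siegel_piece k) \<le> ennreal (r * (\<Prod>i\<in>UNIV. (1 / 2) ^ k i))"
    if k: "k \<in> siegel_index" for k :: "'n \<Rightarrow> nat"
  proof -
    let ?P = "\<Prod>i\<in>UNIV. (2 :: real) ^ k i"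
    have P: "0 < ?P" by (intro prod_pos) auto
    have "emeasure m (siegel_piece k) = emeasure m (siegel_block (\<lambda>i. 1 / 2 ^ k i))"
      unfolding siegel_piece_def by (intro haar(2) ratio_diagonal) (simp add: haar(1) siegel_block_borel)
    also have "\<dots> = ennreal (1 / ?P) * (ennreal ?P * emeasure m (siegel_block (\<lambda>i. 1 / 2 ^ k i)))"
      using P by (simp add: mult.assoc[symmetric] ennreal_mult[symmetric])
    also have "\<dots> \<le> ennreal (1 / ?P) * ennreal r"
    proof (rule mult_left_mono)
      have "ennreal ?P = (\<Prod>i\<in>UNIV. 2 ^ k i)"
        by (simp add: prod_ennreal[symmetric] ennreal_power[symmetric])
      then show "ennreal ?P * emeasure m (siegel_block (\<lambda>i. 1 / 2 ^ k i)) \<le> ennreal r"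
        using siegel_block_packing[OF m, of k] k r by (simp add: siegel_index_def)
    qed simp
    also have "\<dots> = ennreal (r * (\<Prod>i\<in>UNIV. (1 / 2) ^ k i))"
      using r(2) P by (simp add: ennreal_mult[symmetric] power_one_over prod_dividef mult.commute)
    finally show ?thesis .
  qed
  define K where "K N = siegel_index \<inter> (\<Pi>\<^sub>E i\<in>(UNIV :: 'n set). {..N})" for N :: nat
  have fin: "finite (\<Pi>\<^sub>E i\<in>(UNIV :: 'n set). {..N})" for N :: nat by (intro finite_PiE) auto
  define U where "U N = (\<Union>k\<in>K N. siegel_piece k)" for N
  have "emeasure m (U N) \<le> ennreal (r * 2 ^ CARD('n))" for N
  proof -
    have "emeasure m (U N) \<le> (\<Sum>k\<in>K N. emeasure m (siegel_piece k))"
      unfolding U_def using fin siegel_piece_borel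
      by (intro emeasure_subadditive_finite) (auto simp: K_def haar(1))
    also have "\<dots> \<le> (\<Sum>k\<in>K N. ennreal (r * (\<Prod>i\<in>UNIV. (1 / 2) ^ k i)))"
      by (intro sum_mono piece) (simp add: K_def)
    also have "\<dots> = ennreal (\<Sum>k\<in>K N. r * (\<Prod>i\<in>UNIV. (1 / 2) ^ k i))"
      using r(2) by (intro sum_ennreal mult_nonneg_nonneg prod_nonneg) auto
    also have "\<dots> \<le> ennreal (r * 2 ^ CARD('n))"
    proof (rule ennreal_leI)
      have "(\<Sum>k\<in>K N. r * (\<Prod>i\<in>UNIV. (1 / 2) ^ k i))
          \<le> (\<Sum>k\<in>(\<Pi>\<^sub>E i\<in>(UNIV :: 'n set). {..N}). r * (\<Prod>i\<in>UNIV. (1 / 2) ^ k i))"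
        using fin r(2) by (intro sum_mono2 mult_nonneg_nonneg prod_nonneg) (auto simp: K_def)
      also have "\<dots> = r * (\<Prod>i\<in>(UNIV :: 'n set). \<Sum>n\<le>N. (1 / 2) ^ n)"
        unfolding sum_distrib_left[symmetric] by (subst prod_sum_PiE) auto
      also have "\<dots> \<le> r * (\<Prod>i\<in>(UNIV :: 'n set). 2)"
      proof (intro mult_left_mono prod_mono conjI r(2))
        show "(\<Sum>n\<le>N. (1 / 2 :: real) ^ n) \<le> 2"
          by (simp add: sum_gp0 )
      qed (auto intro: sum_nonneg)
      finally show "(\<Sum>k\<in>K N. r * (\<Prod>i\<in>UNIV. (1 / 2) ^ k i)) \<le> r * 2 ^ CARD('n)" by simp
    qed
    finally show ?thesis .
  qed
  then have "(SUP N. emeasure m (U N)) \<le> ennreal (r * 2 ^ CARD('n))" by (intro SUP_least)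
  moreover have "(SUP N. emeasure m (U N)) = emeasure m (\<Union>N. U N)"
  proof (rule SUP_emeasure_incseq)
    show "range U \<subseteq> sets m"
      unfolding U_def haar(1)
      by (intro image_subsetI sets.countable_UN'' countableI_type siegel_piece_borel)
    show "incseq U"
    proof (rule incseq_SucI)
      show "U N \<subseteq> U (Suc N)" for N
        unfolding U_def by (intro UN_mono) (auto simp: K_def PiE_iff le_SucI)
    qed
  qed
  moreover have "(\<Union>N. U N) = (\<Union>k\<in>siegel_index. siegel_piece k)"
  proof
    show "(\<Union>N. U N) \<subseteq> (\<Union>k\<in>siegel_index. siegel_piece k)" by (auto simp: U_def K_def)
    show "(\<Union>k\<in>siegel_index. siegel_piece k) \<subseteq> (\<Union>N. U N)"
    proof
      fix M :: "real^'n^'n" assume "M \<in> (\<Union>k\<in>siegel_index. siegel_piece k)"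
      then obtain k where k: "k \<in> siegel_index" "M \<in> siegel_piece k" by blast
      then have "k \<in> K (Max (range k))" by (simp add: K_def PiE_iff)
      then show "M \<in> (\<Union>N. U N)" using k(2) unfolding U_def by blast
    qed
  qed
  ultimately show ?thesis by (metis ennreal_less_top infinity_ennreal_def order_le_less_trans)
qed

lemma emeasure_fundamental_set_finite:
  assumes m: "left_haar_measure (SL_real :: (real^'n^'n) monoid) m"
    and F: "borel_fundamental_set SL_real (SL_int :: (real^'n^'n) set) F"
  shows "emeasure m F < \<infinity>"
proof -
  note haar = left_haar_measure_SL[OF m]
  have "(\<Union>k\<in>siegel_index. siegel_piece k) \<in> sets m"
    unfolding haar(1) by (intro sets.countable_UN'' countableI_type siegel_piece_borel)
  then have "emeasure m F \<le> emeasure m (\<Union>k\<in>siegel_index. siegel_piece k)"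
    using siegel_pieces_cover by (intro fundamental_set_le_cover[OF m F])
  with emeasure_siegel_set_finite[OF m] show ?thesis by (rule le_less_trans[rotated])
qed

theorem theorem6p1:
  shows "is_lattice (SL_int :: (real^'d^'d) set) (SL_real :: (real^'d^'d) monoid)"
  unfolding is_lattice_def
proof (intro conjI allI impI)
  show "discrete_subgroup (SL_int :: (real^'d^'d) set) SL_real" by (rule discrete_subgroup_SL_int)
  show "\<exists>m. left_haar_measure (SL_real :: (real^'d^'d) monoid) m"
    using left_haar_measure_cone_measure by blast
  show "\<exists>F. borel_fundamental_set SL_real (SL_int :: (real^'d^'d) set) F"
    by (rule ex_borel_fundamental_set)
next
  fix m :: "(real^'d^'d) measure" and F :: "(real^'d^'d) set"
  assume "left_haar_measure SL_real m \<and> borel_fundamental_set SL_real SL_int F"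
  then have m: "left_haar_measure SL_real m" and F: "borel_fundamental_set SL_real SL_int F" by auto
  let ?Q = "quotient_measure SL_real SL_int m F"
  have Fm: "F \<in> sets m"
    using F by (simp add: borel_fundamental_set_def left_haar_measure_SL(1)[OF m])
  have "space ?Q \<in> sets (quotient_borel SL_real (SL_int :: (real^'d^'d) set))"
    by (simp add: quotient_measure_def)
  then have "emeasure ?Q (space ?Q) =
      emeasure m ({g \<in> carrier SL_real. SL_int #>\<^bsub>SL_real\<^esub> g \<in> space ?Q} \<inter> F)"
    by (rule emeasure_quotient_measure[OF m F])
  also have "\<dots> \<le> emeasure m F" using Fm by (rule emeasure_mono[OF Int_lower2])
  also have "\<dots> < \<infinity>" by (rule emeasure_fundamental_set_finite[OF m F])
  finally show "finite_measure ?Q" by (intro finite_measureI) auto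
qed

end
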